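(* Let $G,H\le\operatorname{Aut}(T_X)$ be perfect, self-similar subgroups that both satisfy property H. If the images of $G$ and $H$ in $\operatorname{Sym}(X)$ coincide, then the profinite completions $\widehat{\Gamma_G^{\Omega}}$ and $\widehat{\Gamma_H^{\Omega'}}$ are isomorphic for all non-empty subsets $\Omega,\Omega'\subseteq\mathcal{S}$. If moreover $G$ is a subgroup of $H$ and $\Omega\subseteq\Omega'$, then $\Gamma_G^{\Omega}$ is a subgroup of $\Gamma_H^{\Omega'}$ and the inclusion map $j$ induces an isomorphism $\widehat{j}\colon\widehat{\Gamma_G^{\Omega}}\to\widehat{\Gamma_H^{\Omega'}}$.
   Context: Let $X$ be a non-empty finite set with a fixed element $o\in X$ and $X^+=X\setminus\{o\}$. $X^*$ is the set of finite words over $X$; $T_X$ is the rooted tree with vertex set $X^*$, root the empty word, and edges joining $w$ to $wx$ ($w\in X^*$, $x\in X$); level $\ell$ is $X^\ell$. $\operatorname{Aut}(T_X)$ is the group of root-fixing graph automorphisms. For $\alpha\in\operatorname{Aut}(T_X)$, $\sigma_\alpha\in\operatorname{Sym}(X)$ is the induced permutation of level 1, and for $x\in X$ the state $\alpha_x\in\operatorname{Aut}(T_X)$ is defined by $\alpha(xw)=\sigma_\alpha(x)\alpha_x(w)$ for all $w\in X^*$. The image of a subgroup in $\operatorname{Sym}(X)$ is its image under $\alpha\mapsto\sigma_\alpha$. A subgroup $K\le\operatorname{Aut}(T_X)$ is self-similar if $g_x\in K$ for all $g\in K,x\in X$. It has property H (the name of the property, unrelated to the group $H$) if it acts transitively on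 $X$ and for all $x\ne y$ in $X$ there is $g\in K$ with $g(x)=x$ and $g(y)\ne y$. $\mathcal{S}$ is the set of infinite sequences $\omega=(\omega_k)_{k\ge1}$ over $X^+$; $L(\omega_1,\omega_2,\dots)=(\omega_2,\omega_3,\dots)$. For $\alpha\in\operatorname{Aut}(T_X)$ and $\omega\in\mathcal{S}$, $\widetilde{\alpha}^{\omega}\in\operatorname{Aut}(T_X)$ fixes level 1 pointwise and is given recursively by its states: $\widetilde{\alpha}^{L(\omega)}$ at $o$, $\alpha$ at $\omega_1$, and $\operatorname{id}$ at every other $x\in X$. For a subgroup $K$ and non-empty $\Omega\subseteq\mathcal{S}$, $\Gamma_K^{\Omega}$ is the subgroup of $\operatorname{Aut}(T_X)$ generated by $K$ and all $\widetilde{g}^{\omega}$ with $g\in K,\omega\in\Omega$. The profinite completion of a group $\Gamma$ is $\widehat{\Gamma}=\varprojlim_N\Gamma/N$, $N$ ranging over the finite index normal subgroups. *)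

theory Defs
  imports "HOL-Analysis.Analysis" "HOL-Algebra.Algebra"
begin

section \<open>The rooted tree and its automorphism group\<close>

text \<open>The finite non-empty alphabet \<open>X\<close> is a type of class finite; the vertices of the
  tree are the words over it, and level 1 consists of the words \<open>[x]\<close>.\<close>

definition tree_adj :: "'a list \<Rightarrow> 'a list \<Rightarrow> bool" where
  "tree_adj v w \<longleftrightarrow> (\<exists>x. w = v @ [x]) \<or> (\<exists>x. v = w @ [x])"

definition tree_aut :: "('a list \<Rightarrow> 'a list) monoid" where
  "tree_aut =
     \<lparr>carrier = {\<alpha>. bij \<alpha> \<and> \<alpha> [] = [] \<and> (\<forall>v w. tree_adj (\<alpha> v) (\<alpha> w) \<longleftrightarrow> tree_adj v w)},
      monoid.mult = (\<circ>), one = id\<rparr>"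

text \<open>The permutation of level 1 and the states; \<open>tree_aut_Cons\<close> below shows that they
  satisfy the defining equation \<open>\<alpha> (x # w) = level_perm \<alpha> x # state \<alpha> x w\<close>.\<close>

definition level_perm :: "('a list \<Rightarrow> 'a list) \<Rightarrow> 'a \<Rightarrow> 'a" where
  "level_perm \<alpha> x = hd (\<alpha> [x])"

definition state :: "('a list \<Rightarrow> 'a list) \<Rightarrow> 'a \<Rightarrow> 'a list \<Rightarrow> 'a list" where
  "state \<alpha> x w = tl (\<alpha> (x # w))"

definition self_similar :: "('a list \<Rightarrow> 'a list) set \<Rightarrow> bool" where
  "self_similar K \<longleftrightarrow> (\<forall>g\<in>K. \<forall>x. state g x \<in> K)"

definition property_H :: "('a list \<Rightarrow> 'a list) set \<Rightarrow> bool" where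
  "property_H K \<longleftrightarrow>
     (\<forall>x y. \<exists>g\<in>K. level_perm g x = y) \<and>
     (\<forall>x y. x \<noteq> y \<longrightarrow> (\<exists>g\<in>K. level_perm g x = x \<and> level_perm g y \<noteq> y))"

definition perfect_subgroup :: "('g, 'm) monoid_scheme \<Rightarrow> 'g set \<Rightarrow> bool" where
  "perfect_subgroup \<Gamma> K \<longleftrightarrow> derived \<Gamma> K = K"


section \<open>Directed automorphisms and the groups they generate\<close>

text \<open>Sequences are indexed from 0, so \<open>\<omega> 0\<close> is the first entry. The letter \<open>p\<close> is the
  distinguished element of the alphabet.\<close>

definition seqs :: "'a \<Rightarrow> (nat \<Rightarrow> 'a) set" where
  "seqs p = {\<omega>. \<forall>k. \<omega> k \<noteq> p}"

definition seq_shift :: "(nat \<Rightarrow> 'a) \<Rightarrow> nat \<Rightarrow> 'a" where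
  "seq_shift \<omega> = (\<lambda>k. \<omega> (Suc k))"

primrec directed :: "'a \<Rightarrow> ('a list \<Rightarrow> 'a list) \<Rightarrow> 'a list \<Rightarrow> (nat \<Rightarrow> 'a) \<Rightarrow> 'a list" where
  "directed p \<alpha> [] \<omega> = []"
| "directed p \<alpha> (x # w) \<omega> =
     x # (if x = p then directed p \<alpha> w (seq_shift \<omega>)
          else if x = \<omega> 0 then \<alpha> w
          else w)"

definition directed_aut :: "'a \<Rightarrow> ('a list \<Rightarrow> 'a list) \<Rightarrow> (nat \<Rightarrow> 'a) \<Rightarrow> 'a list \<Rightarrow> 'a list" where
  "directed_aut p \<alpha> \<omega> = (\<lambda>w. directed p \<alpha> w \<omega>)"

definition Gamma_group ::
    "'a \<Rightarrow> ('a list \<Rightarrow> 'a list) set \<Rightarrow> (nat \<Rightarrow> 'a) set \<Rightarrow> ('a list \<Rightarrow> 'a list) monoid" where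
  "Gamma_group p K \<Omega> =
     subgroup_generated tree_aut (K \<union> {directed_aut p g \<omega> | g \<omega>. g \<in> K \<and> \<omega> \<in> \<Omega>})"


section \<open>Profinite completions\<close>

definition fin_index_normal :: "('g, 'm) monoid_scheme \<Rightarrow> 'g set set" where
  "fin_index_normal \<Gamma> = {N. N \<lhd> \<Gamma> \<and> finite (carrier (\<Gamma> Mod N))}"

text \<open>For \<open>N \<subseteq> M\<close> the projection from \<open>\<Gamma> Mod N\<close> to \<open>\<Gamma> Mod M\<close> sends a coset \<open>N x\<close>
  to \<open>M x\<close>, that is, a coset \<open>C\<close> to the product set \<open>M C\<close>.\<close>

definition profinite_completion :: "('g, 'm) monoid_scheme \<Rightarrow> ('g set \<Rightarrow> 'g set) monoid" where
  "profinite_completion \<Gamma> =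
     (product_group (fin_index_normal \<Gamma>) (\<lambda>N. \<Gamma> Mod N))
       \<lparr>carrier :=
          {f \<in> \<Pi>\<^sub>E N\<in>fin_index_normal \<Gamma>. carrier (\<Gamma> Mod N).
             \<forall>N\<in>fin_index_normal \<Gamma>. \<forall>M\<in>fin_index_normal \<Gamma>.
               N \<subseteq> M \<longrightarrow> f M = M <#>\<^bsub>\<Gamma>\<^esub> f N}\<rparr>"

definition profinite_topology :: "('g, 'm) monoid_scheme \<Rightarrow> ('g set \<Rightarrow> 'g set) topology" where
  "profinite_topology \<Gamma> =
     subtopology
       (product_topology (\<lambda>N. discrete_topology (carrier (\<Gamma> Mod N))) (fin_index_normal \<Gamma>))
       (carrier (profinite_completion \<Gamma>))"

definition profinite_isomorphism ::
    "('g, 'm) monoid_scheme \<Rightarrow> ('h, 'n) monoid_scheme \<Rightarrow>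
     (('g set \<Rightarrow> 'g set) \<Rightarrow> ('h set \<Rightarrow> 'h set)) \<Rightarrow> bool" where
  "profinite_isomorphism \<Gamma> \<Delta> \<theta> \<longleftrightarrow>
     \<theta> \<in> iso (profinite_completion \<Gamma>) (profinite_completion \<Delta>) \<and>
     homeomorphic_map (profinite_topology \<Gamma>) (profinite_topology \<Delta>) \<theta>"

text \<open>The map induced by a homomorphism \<open>\<phi>\<close>: its component at \<open>M\<close> is the composition of
  the projection to \<open>\<Gamma> Mod N\<close>, where \<open>N\<close> is the preimage of \<open>M\<close>, with the homomorphism
  from \<open>\<Gamma> Mod N\<close> to \<open>\<Delta> Mod M\<close> sending \<open>N x\<close> to \<open>M (\<phi> x)\<close>.\<close>

definition profinite_map ::
    "('g, 'm) monoid_scheme \<Rightarrow> ('h, 'n) monoid_scheme \<Rightarrow> ('g \<Rightarrow> 'h) \<Rightarrow>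
     ('g set \<Rightarrow> 'g set) \<Rightarrow> ('h set \<Rightarrow> 'h set)" where
  "profinite_map \<Gamma> \<Delta> \<phi> f =
     (\<lambda>M\<in>fin_index_normal \<Delta>. M <#>\<^bsub>\<Delta>\<^esub> (\<phi> ` f {x \<in> carrier \<Gamma>. \<phi> x \<in> M}))"


section \<open>Well-definedness\<close>

lemma tree_aut_group: "group (tree_aut :: ('a list \<Rightarrow> 'a list) monoid)"
proof (rule groupI)
  fix \<alpha> :: "'a list \<Rightarrow> 'a list" assume a: "\<alpha> \<in> carrier tree_aut"
  then have b: "bij \<alpha>" by (simp add: tree_aut_def)
  have "inv_into UNIV \<alpha> \<in> carrier tree_aut"
    using a b unfolding tree_aut_def
    by simp (metis bij_imp_bij_inv bij_inv_eq_iff)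
  moreover have "inv_into UNIV \<alpha> \<circ> \<alpha> = id" using b by (simp add: bij_is_inj)
  ultimately show "\<exists>\<beta>\<in>carrier tree_aut. \<beta> \<otimes>\<^bsub>tree_aut\<^esub> \<alpha> = \<one>\<^bsub>tree_aut\<^esub>"
    by (auto simp: tree_aut_def)
qed (auto simp: tree_aut_def comp_assoc intro: bij_comp)

lemma tree_aut_length_snoc:
  assumes "\<alpha> \<in> carrier tree_aut"
  shows "length (\<alpha> w) = length w \<and> (\<exists>y. \<alpha> (w @ [x]) = \<alpha> w @ [y])"
proof -
  have adj: "tree_adj (\<alpha> v) (\<alpha> (v @ [y]))" for v y
  proof -
    have "tree_adj v (v @ [y])" by (simp add: tree_adj_def)
    then show ?thesis using assms by (simp add: tree_aut_def)
  qed
  show ?thesis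
  proof (induction w arbitrary: x rule: rev_induct)
    case Nil
    have "tree_adj (\<alpha> []) (\<alpha> [x])" "\<alpha> [] = []"
      using assms adj[of "[]"] by (simp_all add: tree_aut_def)
    then show ?case by (auto simp: tree_adj_def)
  next
    case (snoc z w)
    then obtain y where y: "\<alpha> (w @ [z]) = \<alpha> w @ [y]" by blast
    have len: "length (\<alpha> (w @ [z])) = length (w @ [z])" using y snoc by simp
    have "tree_adj (\<alpha> (w @ [z])) (\<alpha> ((w @ [z]) @ [x]))"
      by (rule adj)
    moreover have "\<alpha> (w @ [z]) \<noteq> \<alpha> ((w @ [z]) @ [x]) @ [u]" for u
    proof
      assume "\<alpha> (w @ [z]) = \<alpha> ((w @ [z]) @ [x]) @ [u]"
      then have "\<alpha> w = \<alpha> ((w @ [z]) @ [x])" using y by simp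
      moreover have "inj \<alpha>" using assms by (auto simp: tree_aut_def bij_is_inj)
      ultimately have "w = (w @ [z]) @ [x]" by (simp add: inj_eq)
      then show False by simp
    qed
    ultimately show ?case using len by (auto simp: tree_adj_def)
  qed
qed

lemma tree_aut_Cons:
  assumes "\<alpha> \<in> carrier tree_aut"
  shows "\<alpha> (x # w) = level_perm \<alpha> x # state \<alpha> x w"
proof -
  have "\<alpha> (x # w) \<noteq> [] \<and> hd (\<alpha> (x # w)) = level_perm \<alpha> x"
  proof (induction w rule: rev_induct)
    case Nil
    have "length (\<alpha> [x]) = 1" using tree_aut_length_snoc[OF assms, of "[x]"] by simp
    then show ?case by (auto simp: level_perm_def)
  next
    case (snoc y w)
    then show ?case using tree_aut_length_snoc[OF assms, of "x # w" y] by auto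
  qed
  then show ?thesis by (metis list.collapse state_def)
qed

lemma directed_aut_in_tree_aut:
  assumes "\<alpha> \<in> carrier tree_aut"
  shows "directed_aut p \<alpha> \<omega> \<in> carrier tree_aut"
proof -
  have bij: "bij \<alpha>" and adj: "\<And>v w. tree_adj (\<alpha> v) (\<alpha> w) \<longleftrightarrow> tree_adj v w"
    and nil: "\<alpha> [] = []"
    using assms by (auto simp: tree_aut_def)
  have ConsC: "tree_adj (x # v) (y # w) \<longleftrightarrow> x = y \<and> tree_adj v w" for x y :: 'a and v w
    by (auto simp: tree_adj_def)
  have Nil1: "tree_adj [] (y # w) \<longleftrightarrow> w = []" for y :: 'a and w
    by (auto simp: tree_adj_def)
  have Nil2: "tree_adj (y # w) [] \<longleftrightarrow> w = []" for y :: 'a and w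
    by (auto simp: tree_adj_def)
  have a0: "\<alpha> w = [] \<longleftrightarrow> w = []" for w using bij nil by (metis bij_is_inj injD)
  have d0: "directed p \<alpha> w \<omega> = [] \<longleftrightarrow> w = []" for w \<omega> by (cases w) auto
  have "\<exists>v. directed p \<alpha> v \<omega> = w" for w \<omega>
  proof (induction w arbitrary: \<omega>)
    case Nil then show ?case using d0 by blast
  next
    case (Cons x w)
    obtain v1 where v1: "directed p \<alpha> v1 (seq_shift \<omega>) = w" using Cons by blast
    obtain v2 where v2: "\<alpha> v2 = w" using bij by (metis bij_pointE)
    have "directed p \<alpha> (x # (if x = p then v1 else if x = \<omega> 0 then v2 else w)) \<omega> = x # w"
      using v1 v2 by simp
    then show ?case by blast
  qed
  moreover have "directed p \<alpha> v \<omega> = directed p \<alpha> w \<omega> \<Longrightarrow> v = w" for v w \<omega>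
  proof (induction v arbitrary: w \<omega>)
    case Nil then show ?case by (metis d0 directed.simps(1))
  next
    case (Cons x v)
    then obtain w' where "w = x # w'" by (cases w) auto
    with Cons bij show ?case by (auto split: if_splits simp: bij_is_inj inj_eq)
  qed
  moreover have "tree_adj (directed p \<alpha> v \<omega>) (directed p \<alpha> w \<omega>) \<longleftrightarrow> tree_adj v w" for v w \<omega>
  proof (induction v arbitrary: w \<omega>)
    case Nil
    show ?case by (cases w) (simp_all add: Nil1 a0 d0)
  next
    case (Cons x v)
    show ?case
      by (cases w) (auto simp: Nil2 a0 d0 ConsC adj Cons)
  qed
  ultimately show ?thesis
    unfolding tree_aut_def directed_aut_def bij_def inj_def surj_def
    by simp metis
qed

end

theory Submission
  imports Defs
begin

text \<open>
  The profinite completion of the group \<open>\<Gamma> = \<Gamma>\<^sub>G\<^sup>\<Omega>\<close> depends only on the finite actions of \<open>\<Gamma>\<close> on the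
  levels of the tree, and these depend only on the image of \<open>G\<close> in the symmetric group.

  Property H is used to cut a directed automorphism into pieces. Let \<open>h \<in> G\<close> fix \<open>\<omega> 0\<close> and move
  \<open>p\<close>. The directed automorphism of \<open>g\<close> and the \<open>h\<close>-conjugate of the one of \<open>g'\<close> overlap only
  below \<open>\<omega> 0\<close>, so their commutator is concentrated there, and it is a commutator of \<open>G\<close>. As \<open>G\<close>
  is perfect and transitive on letters, \<open>\<Gamma>\<close> contains a copy of \<open>G\<close> below every single letter,
  hence also the remaining part of a directed automorphism, its state at \<open>p\<close>. This gives the
  wreath recursion \<open>\<Gamma>_wreath_recursion\<close>: a tree automorphism lies in \<open>\<Gamma>\<close> if and only if its action
  on letters comes from \<open>G\<close> and all its states lie in the group \<open>\<Gamma>'\<close> belonging to the shifted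
  sequences.

  Two consequences carry the theorem. Iterating the recursion, groups with the same
  permutations of letters have the same action on each level (\<open>level_approximation\<close>). And
  \<open>\<Gamma>\<close> has the congruence subgroup property: iterating again, the stabiliser of level \<open>n\<close> is
  the direct product over the vertices \<open>v\<close> of level \<open>n\<close> of copies of a group of the same
  kind. If a normal subgroup \<open>N\<close> contains an element \<open>\<alpha>\<close> that moves \<open>v\<close>, then for \<open>a\<close>, \<open>b\<close> supported
  below \<open>v\<close> the commutator \<open>[[a, \<alpha>], b] = [a, b]\<close> lies in \<open>N\<close>, so by perfectness \<open>N\<close>
  contains the whole factor at \<open>v\<close>, and by transitivity all factors. A normal subgroup of
  finite index is nontrivial because \<open>\<Gamma>\<close> is infinite; so it contains a level stabiliser.

  For nested groups these two facts say that every coset of a finite index normal subgroup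
  of the larger group meets the smaller one, and that every finite index normal subgroup of
  the smaller group contains the trace of one of the larger group. By
  \<open>profinite_map_inclusion_iso\<close> the inclusion then induces an isomorphism of profinite
  completions. For arbitrary \<open>G\<close> and \<open>H\<close>, the group \<open>K\<close> that they generate is again perfect and
  self-similar, has property H and the same image in the symmetric group; so both groups
  embed into \<open>\<Gamma>\<^sub>K\<close>, formed with the union of the two sets of sequences, with the same
  profinite completion.
\<close>

section \<open>Cosets and the profinite completion of a subgroup\<close>

lemma (in group) set_mult_rcoset:
  assumes "subgroup M G" "N \<subseteq> M" "\<one> \<in> N" "x \<in> carrier G"
  shows "M <#> (N #> x) = M #> x"
proof -
  interpret M: subgroup M G by fact
  have NG: "N \<subseteq> carrier G" using assms(2) M.subset by blast
  have "M <#> N = M"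
  proof
    show "M <#> N \<subseteq> M" using assms(2) by (auto simp: set_mult_def)
    show "M \<subseteq> M <#> N"
    proof
      fix m assume "m \<in> M"
      then have "m = m \<otimes> \<one>" "m \<in> M" by simp_all
      then show "m \<in> M <#> N" using assms(3) unfolding set_mult_def by blast
    qed
  qed
  then show ?thesis using setmult_rcos_assoc[OF M.subset NG assms(4)] by simp
qed

lemma (in group) rcoset_of_member:
  assumes "subgroup M G" "C \<in> rcosets M" "x \<in> C"
  shows "C = M #> x" "x \<in> carrier G"
proof -
  obtain y where y: "y \<in> carrier G" "C = M #> y" using assms(2) by (auto simp: RCOSETS_def)
  show "C = M #> x" using repr_independence[OF _ y(1) assms(1)] assms(3) y(2) by simp
  show "x \<in> carrier G" using assms y r_coset_subset_G[OF subgroup.subset[OF assms(1)]] by blast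
qed

lemma (in group) rcoset_subset_iff:
  assumes "subgroup M G" "subgroup N G" "N \<subseteq> M" "C \<in> rcosets N" "D \<in> rcosets M"
  shows "D = M <#> C \<longleftrightarrow> C \<subseteq> D"
proof -
  obtain x where x: "x \<in> carrier G" "C = N #> x" using assms(4) by (auto simp: RCOSETS_def)
  have MC: "M <#> C = M #> x"
    using set_mult_rcoset[OF assms(1,3) subgroup.one_closed[OF assms(2)] x(1)] x(2) by simp
  have xC: "x \<in> C" using x rcos_self[OF _ assms(2)] by simp
  have "C \<subseteq> M #> x" using x(2) assms(3) by (auto simp: r_coset_def)
  then show ?thesis
    using MC xC rcoset_of_member(1)[OF assms(1,5)] by auto
qed

text \<open>
  Used to bound the number of cosets of a subgroup by sending a coset representative to
  finitely many data that determine the coset.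
\<close>

lemma finite_image_if_factors:
  assumes "finite (\<Phi> ` A)" "\<And>x y. x \<in> A \<Longrightarrow> y \<in> A \<Longrightarrow> \<Phi> x = \<Phi> y \<Longrightarrow> h x = h y"
  shows "finite (h ` A)"
proof -
  have "h ` A \<subseteq> (\<lambda>z. h (inv_into A \<Phi> z)) ` \<Phi> ` A"
  proof
    fix z assume "z \<in> h ` A"
    then obtain x where x: "x \<in> A" "z = h x" by blast
    have "h (inv_into A \<Phi> (\<Phi> x)) = h x"
      using x(1) by (intro assms(2)) (auto simp: inv_into_into f_inv_into_f)
    then show "z \<in> (\<lambda>z. h (inv_into A \<Phi> z)) ` \<Phi> ` A" using x by force
  qed
  then show ?thesis using assms(1) by (meson finite_imageI finite_subset)
qed

lemma fin_index_normalD: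
  assumes "N \<in> fin_index_normal G"
  shows "N \<lhd> G" "subgroup N G" "finite (rcosets\<^bsub>G\<^esub> N)"
  using assms by (auto simp: fin_index_normal_def FactGroup_def normal_imp_subgroup)

lemma (in group) rcoset_eq_iff:
  assumes "subgroup N G" "x \<in> carrier G" "y \<in> carrier G"
  shows "N #> x = N #> y \<longleftrightarrow> x \<otimes> inv y \<in> N"
  using assms
  by (metis group.rcos_self group.repr_independence is_group subgroup.rcos_module)

lemma (in group) fin_index_normal_inter:
  assumes "M \<in> fin_index_normal G" "N \<in> fin_index_normal G"
  shows "M \<inter> N \<in> fin_index_normal G"
proof -
  note M = fin_index_normalD[OF assms(1)] and N = fin_index_normalD[OF assms(2)]
  have sub: "subgroup (M \<inter> N) G" using M(2) N(2) by (rule subgroups_Inter_pair)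
  have "finite ((\<lambda>x. (M \<inter> N) #> x) ` carrier G)"
  proof (rule finite_image_if_factors)
    show "finite ((\<lambda>x. (M #> x, N #> x)) ` carrier G)"
      by (rule finite_subset[of _ "(rcosets M) \<times> (rcosets N)"])
         (use M(3) N(3) in \<open>auto simp: RCOSETS_def\<close>)
  qed (use sub M(2) N(2) in \<open>auto simp: rcoset_eq_iff\<close>)
  then show ?thesis
    using M(1) N(1) by (simp add: fin_index_normal_def normal_subgroup_intersect carrier_FactGroup)
qed

lemma (in group) fin_index_normal_restrict:
  assumes "subgroup A G" "M \<in> fin_index_normal G"
  shows "A \<inter> M \<in> fin_index_normal (G\<lparr>carrier := A\<rparr>)"
proof -
  note M = fin_index_normalD[OF assms(2)]
  have "finite ((\<lambda>x. (A \<inter> M) #> x) ` A)"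
  proof (rule finite_image_if_factors)
    show "finite ((\<lambda>x. M #> x) ` A)"
      by (rule finite_subset[OF _ M(3)])
         (use subgroup.subset[OF assms(1)] in \<open>auto simp: RCOSETS_def\<close>)
    fix x y assume xy: "x \<in> A" "y \<in> A" "M #> x = M #> y"
    then show "(A \<inter> M) #> x = (A \<inter> M) #> y"
      using assms(1) M(2) subgroups_Inter_pair[OF assms(1) M(2)]
      by (auto simp: rcoset_eq_iff subgroup.mem_carrier subgroup.m_closed subgroup.m_inv_closed)
  qed
  then show ?thesis
    using normal_Int_subgroup[OF assms(1) M(1)]
    by (simp add: fin_index_normal_def carrier_FactGroup Int_commute)
qed

text \<open>
  The compatibility condition on a family of cosets, written as an inclusion: the coset of
  the larger subgroup is the one that contains the coset of the smaller subgroup.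
\<close>

lemma (in group) carrier_profinite_completion:
  "f \<in> carrier (profinite_completion G) \<longleftrightarrow>
     f \<in> extensional (fin_index_normal G) \<and>
     (\<forall>N\<in>fin_index_normal G. f N \<in> rcosets N) \<and>
     (\<forall>N\<in>fin_index_normal G. \<forall>M\<in>fin_index_normal G. N \<subseteq> M \<longrightarrow> f N \<subseteq> f M)"
  (is "_ \<longleftrightarrow> ?R")
proof -
  have pc: "f \<in> carrier (profinite_completion G) \<longleftrightarrow>
      f \<in> extensional (fin_index_normal G) \<and> (\<forall>N\<in>fin_index_normal G. f N \<in> rcosets N) \<and>
      (\<forall>N\<in>fin_index_normal G. \<forall>M\<in>fin_index_normal G. N \<subseteq> M \<longrightarrow> f M = M <#> f N)"
    by (simp add: profinite_completion_def FactGroup_def PiE_iff conj_ac)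
  have "f M = M <#> f N \<longleftrightarrow> f N \<subseteq> f M"
    if "N \<in> fin_index_normal G" "M \<in> fin_index_normal G" "N \<subseteq> M"
      "\<forall>N\<in>fin_index_normal G. f N \<in> rcosets N" for M N
    by (intro rcoset_subset_iff fin_index_normalD(2)) (use that in blast)+
  then show ?thesis
    unfolding pc by (intro conj_cong refl ball_cong imp_cong) simp_all
qed

lemma mult_profinite_completion:
  "f \<otimes>\<^bsub>profinite_completion G\<^esub> g = (\<lambda>N\<in>fin_index_normal G. f N <#>\<^bsub>G\<^esub> g N)"
  by (simp add: profinite_completion_def product_group_def)

lemma topspace_profinite_topology:
  "topspace (profinite_topology G) = carrier (profinite_completion G)"
  by (auto simp: profinite_topology_def profinite_completion_def)

text \<open>
  A map that looks at a single component takes values in a discrete space, hence is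
  continuous; by the next lemma, a map into a profinite completion is continuous as soon as
  each of its components looks at a single component of its argument. This is how both the
  induced map and its inverse are seen to be continuous.
\<close>

lemma continuous_map_profinite_component:
  assumes "N \<in> fin_index_normal G" "h \<in> rcosets\<^bsub>G\<^esub> N \<rightarrow> S"
  shows "continuous_map (profinite_topology G) (discrete_topology S) (\<lambda>f. h (f N))"
proof -
  have "continuous_map (profinite_topology G) (discrete_topology (rcosets\<^bsub>G\<^esub> N)) (\<lambda>f. f N)"
    unfolding profinite_topology_def FactGroup_def
    using continuous_map_product_projection[OF assms(1), of "\<lambda>N. discrete_topology (rcosets\<^bsub>G\<^esub> N)"]
    by (auto intro: continuous_map_from_subtopology)
  moreover have "continuous_map (discrete_topology (rcosets\<^bsub>G\<^esub> N)) (discrete_topology S) h"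
    using assms(2) by simp
  ultimately show ?thesis
    using continuous_map_compose[of _ _ "\<lambda>f. f N" _ h] by (simp add: o_def)
qed

lemma continuous_map_into_profinite:
  assumes "f ` topspace T \<subseteq> carrier (profinite_completion G)"
    and "\<And>N. N \<in> fin_index_normal G \<Longrightarrow>
           continuous_map T (discrete_topology (rcosets\<^bsub>G\<^esub> N)) (\<lambda>x. f x N)"
  shows "continuous_map T (profinite_topology G) f"
proof -
  have "carrier (profinite_completion G) \<subseteq> extensional (fin_index_normal G)"
    by (simp add: profinite_completion_def PiE_def subset_iff)
  then have "f ` topspace T \<subseteq> extensional (fin_index_normal G)"
    using assms(1) by (rule subset_trans[rotated])
  then show ?thesis
    unfolding profinite_topology_def continuous_map_in_subtopology continuous_map_componentwise
    using assms by (simp add: FactGroup_def image_subset_iff_funcset)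
qed

text \<open>
  The component at \<open>M\<close> of the image of \<open>f\<close> is the coset of \<open>M\<close> containing \<open>f (A \<inter> M)\<close>. In the
  other direction, the density hypothesis makes the trace on \<open>A\<close> of a coset of \<open>M\<close> a coset of
  \<open>A \<inter> M\<close>, and if \<open>A \<inter> M \<subseteq> N\<close> this coset lies in exactly one coset of \<open>N\<close>. This defines
  the inverse map; it does not depend on \<open>M\<close>, since two choices can be compared through their
  intersection.
\<close>

theorem (in group) profinite_map_inclusion_iso:
  assumes A: "subgroup A G"
    and dense: "\<And>M x. M \<in> fin_index_normal G \<Longrightarrow> x \<in> carrier G \<Longrightarrow> (M #> x) \<inter> A \<noteq> {}"
    and cofinal: "\<And>N. N \<in> fin_index_normal (G\<lparr>carrier := A\<rparr>) \<Longrightarrow>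
                    \<exists>M\<in>fin_index_normal G. A \<inter> M \<subseteq> N"
  shows "profinite_isomorphism (G\<lparr>carrier := A\<rparr>) G (profinite_map (G\<lparr>carrier := A\<rparr>) G (\<lambda>x. x))"
proof -
  define \<Gamma> where "\<Gamma> = G\<lparr>carrier := A\<rparr>"
  interpret \<Gamma>: group \<Gamma> unfolding \<Gamma>_def by (rule subgroup_imp_group[OF A])
  interpret A: subgroup A G by (rule A)
  define j where "j = profinite_map \<Gamma> G (\<lambda>x. x)"
  have cosets: "N #>\<^bsub>\<Gamma>\<^esub> x = N #> x" "K <#>\<^bsub>\<Gamma>\<^esub> L = K <#> L" for N x K L
    by (simp_all add: \<Gamma>_def)
  have carrier: "carrier \<Gamma> = A" by (simp add: \<Gamma>_def)
  have sub\<Gamma>: "subgroup N G" if "N \<in> fin_index_normal \<Gamma>" for N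
    using fin_index_normalD(2)[OF that] incl_subgroup[OF A] by (simp add: \<Gamma>_def)
  have one\<Gamma>: "\<one> \<in> N" if "N \<in> fin_index_normal \<Gamma>" for N
    using sub\<Gamma>[OF that] by (rule subgroup.one_closed)
  have pull: "A \<inter> M \<in> fin_index_normal \<Gamma>" if "M \<in> fin_index_normal G" for M
    unfolding \<Gamma>_def by (rule fin_index_normal_restrict[OF A that])
  have rcos\<Gamma>: "C = N #> x \<and> x \<in> A"
    if "N \<in> fin_index_normal \<Gamma>" "C \<in> rcosets\<^bsub>\<Gamma>\<^esub> N" "x \<in> C" for C N x
    using \<Gamma>.rcoset_of_member[OF fin_index_normalD(2)[OF that(1)] that(2,3)] by (simp add: cosets carrier)
  have rcos\<Gamma>I: "N #> x \<in> rcosets\<^bsub>\<Gamma>\<^esub> N" if "x \<in> A" for N x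
    using that by (auto simp: RCOSETS_def cosets carrier)
  have rcosG: "C = N #> x \<and> x \<in> carrier G"
    if "N \<in> fin_index_normal G" "C \<in> rcosets N" "x \<in> C" for C N x
    using rcoset_of_member[OF fin_index_normalD(2)[OF that(1)] that(2,3)] by simp
  have trace: "(M #> x) \<inter> A = (A \<inter> M) #> x" if "M \<in> fin_index_normal G" "x \<in> A" for M x
  proof -
    have "m \<in> A" if "m \<in> M" "m \<otimes> x \<in> A" for m
    proof -
      have "m \<in> carrier G"
        using that(1) \<open>M \<in> _\<close> by (meson fin_index_normalD(2) subgroup.mem_carrier)
      then have "m = (m \<otimes> x) \<otimes> inv x" using \<open>x \<in> A\<close> by (simp add: m_assoc)
      then show ?thesis using that(2) \<open>x \<in> A\<close> by (metis A.m_closed A.m_inv_closed)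
    qed
    then show ?thesis using \<open>x \<in> A\<close> by (auto simp: r_coset_def)
  qed
  have jM: "j f M = M <#> f (A \<inter> M)" if "M \<in> fin_index_normal G" for f M
  proof -
    have "{x \<in> carrier \<Gamma>. x \<in> M} = A \<inter> M" by (auto simp: carrier)
    then show ?thesis using that by (simp add: j_def profinite_map_def)
  qed
  have hat: "f \<in> extensional (fin_index_normal \<Gamma>)" "\<And>N. N \<in> fin_index_normal \<Gamma> \<Longrightarrow> f N \<in> rcosets\<^bsub>\<Gamma>\<^esub> N"
     "\<And>N M. N \<in> fin_index_normal \<Gamma> \<Longrightarrow> M \<in> fin_index_normal \<Gamma> \<Longrightarrow> N \<subseteq> M \<Longrightarrow> f N \<subseteq> f M"
    if "f \<in> carrier (profinite_completion \<Gamma>)" for f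
    using that unfolding \<Gamma>.carrier_profinite_completion by auto
  have hatG: "f \<in> extensional (fin_index_normal G)" "\<And>N. N \<in> fin_index_normal G \<Longrightarrow> f N \<in> rcosets N"
     "\<And>N M. N \<in> fin_index_normal G \<Longrightarrow> M \<in> fin_index_normal G \<Longrightarrow> N \<subseteq> M \<Longrightarrow> f N \<subseteq> f M"
    if "f \<in> carrier (profinite_completion G)" for f
    using that unfolding carrier_profinite_completion by auto
  have nonempty: "\<exists>x. x \<in> f N \<and> x \<in> A \<and> f N = N #> x"
    if "f \<in> carrier (profinite_completion \<Gamma>)" "N \<in> fin_index_normal \<Gamma>" for f N
    using hat(2)[OF that] \<Gamma>.rcos_self[OF _ fin_index_normalD(2)[OF that(2)]]
    by (auto simp: RCOSETS_def cosets carrier)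
  have jcoset: "j f M = M #> x" if "M \<in> fin_index_normal G" "x \<in> A" "f (A \<inter> M) = (A \<inter> M) #> x" for f M x
    using that one\<Gamma>[OF pull[OF that(1)]] by (simp add: jM set_mult_rcoset fin_index_normalD(2))
  have jinto: "j f \<in> carrier (profinite_completion G)"
    if f: "f \<in> carrier (profinite_completion \<Gamma>)" for f
    unfolding carrier_profinite_completion
  proof (intro conjI ballI impI)
    show "j f \<in> extensional (fin_index_normal G)" by (simp add: j_def profinite_map_def)
    show "j f M \<in> rcosets M" if "M \<in> fin_index_normal G" for M
      using nonempty[OF f pull[OF that]] jcoset[OF that, of _ f] by (auto simp: RCOSETS_def)
    fix N M assume NM: "N \<in> fin_index_normal G" "M \<in> fin_index_normal G" "N \<subseteq> M"
    obtain x where x: "x \<in> f (A \<inter> N)" "x \<in> A" "f (A \<inter> N) = (A \<inter> N) #> x"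
      using nonempty[OF f pull[OF NM(1)]] by blast
    have "x \<in> f (A \<inter> M)" using x(1) hat(3)[OF f pull[OF NM(1)] pull[OF NM(2)]] NM(3) by blast
    then have "f (A \<inter> M) = (A \<inter> M) #> x"
      using rcos\<Gamma>[OF pull[OF NM(2)] hat(2)[OF f pull[OF NM(2)]]] by blast
    then show "j f N \<subseteq> j f M" using x NM by (auto simp: jcoset r_coset_def)
  qed
  obtain c where c: "\<And>N. N \<in> fin_index_normal \<Gamma> \<Longrightarrow> c N \<in> fin_index_normal G \<and> A \<inter> c N \<subseteq> N"
    using cofinal unfolding \<Gamma>_def[symmetric] by metis
  \<comment> \<open>The inverse map reads off the component at \<open>N\<close> from the component at \<open>c N\<close>.\<close>
  define k where "k g = (\<lambda>N\<in>fin_index_normal \<Gamma>. N <#> (g (c N) \<inter> A))" for g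
  have kcoset: "k g N = N #> x"
    if g: "g \<in> carrier (profinite_completion G)" and N: "N \<in> fin_index_normal \<Gamma>"
      and M: "M \<in> fin_index_normal G" "A \<inter> M \<subseteq> N" and x: "x \<in> g M" "x \<in> A" for g N M x
  proof -
    \<comment> \<open>A point \<open>y\<close> in the component at \<open>M \<inter> c N\<close> lies in both components to be compared.\<close>
    have M0: "M \<inter> c N \<in> fin_index_normal G" using fin_index_normal_inter M(1) c[OF N] by blast
    obtain z where z: "z \<in> carrier G" "g (M \<inter> c N) = (M \<inter> c N) #> z"
      using hatG(2)[OF g M0] by (auto simp: RCOSETS_def)
    obtain y where y: "y \<in> g (M \<inter> c N)" "y \<in> A" using dense[OF M0 z(1)] z(2) by auto
    have "y \<in> g M" "y \<in> g (c N)"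
      using y(1) hatG(3)[OF g M0] M(1) c[OF N] by blast+
    then have "g M = M #> y" "g (c N) = c N #> y"
      using rcosG M(1) c[OF N] hatG(2)[OF g] by blast+
    then have "x \<in> (A \<inter> M) #> y" "g (c N) \<inter> A = (A \<inter> c N) #> y"
      using x trace[OF _ y(2)] M(1) c[OF N] by blast+
    moreover have "N <#> ((A \<inter> c N) #> y) = N #> y"
      using c[OF N] one\<Gamma>[OF pull] y(2) by (intro set_mult_rcoset sub\<Gamma>[OF N]) auto
    ultimately have "x \<in> N #> y" "k g N = N #> y"
      using M(2) N by (auto simp: k_def r_coset_def)
    then show ?thesis
      using repr_independence[OF _ A.mem_carrier[OF y(2)] sub\<Gamma>[OF N], of x] by simp
  qed
  have meet: "\<exists>x. x \<in> g M \<and> x \<in> A" if "g \<in> carrier (profinite_completion G)" "M \<in> fin_index_normal G" for g M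
    using hatG(2)[OF that] dense[OF that(2)] by (auto simp: RCOSETS_def)
  have kinto: "k g \<in> carrier (profinite_completion \<Gamma>)"
    if g: "g \<in> carrier (profinite_completion G)" for g
    unfolding \<Gamma>.carrier_profinite_completion
  proof (intro conjI ballI impI)
    show "k g \<in> extensional (fin_index_normal \<Gamma>)" by (simp add: k_def)
    show "k g N \<in> rcosets\<^bsub>\<Gamma>\<^esub> N" if "N \<in> fin_index_normal \<Gamma>" for N
      using meet[OF g, of "c N"] kcoset[OF g that, of "c N"] c[OF that] rcos\<Gamma>I by fastforce
    fix N M assume NM: "N \<in> fin_index_normal \<Gamma>" "M \<in> fin_index_normal \<Gamma>" "N \<subseteq> M"
    obtain x where x: "x \<in> g (c N)" "x \<in> A" using meet[OF g] c[OF NM(1)] by blast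
    have "k g N = N #> x" "k g M = M #> x"
      using kcoset[OF g _ _ _ x] NM c[OF NM(1)] by blast+
    then show "k g N \<subseteq> k g M" using NM(3) by (auto simp: r_coset_def)
  qed
  have kj: "k (j f) = f" if f: "f \<in> carrier (profinite_completion \<Gamma>)" for f
  proof (rule extensionalityI[of _ "fin_index_normal \<Gamma>"])
    show "k (j f) \<in> extensional (fin_index_normal \<Gamma>)" by (simp add: k_def)
    show "f \<in> extensional (fin_index_normal \<Gamma>)" by (rule hat(1)[OF f])
    fix N assume N: "N \<in> fin_index_normal \<Gamma>"
    have cN: "c N \<in> fin_index_normal G" "A \<inter> c N \<subseteq> N" using c[OF N] by auto
    obtain x where x: "x \<in> f (A \<inter> c N)" "x \<in> A" "f (A \<inter> c N) = (A \<inter> c N) #> x"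
      using nonempty[OF f pull[OF cN(1)]] by blast
    have "x \<in> j f (c N)"
      using jcoset[where f = f, OF cN(1) x(2,3)] rcos_self[OF A.mem_carrier[OF x(2)] fin_index_normalD(2)[OF cN(1)]]
      by simp
    then have "k (j f) N = N #> x" using kcoset[OF jinto[OF f] N cN _ x(2)] by blast
    moreover have "f N = N #> x"
      using rcos\<Gamma>[OF N hat(2)[OF f N]] x(1) hat(3)[OF f pull[OF cN(1)] N cN(2)] by blast
    ultimately show "k (j f) N = f N" by simp
  qed
  have jk: "j (k g) = g" if g: "g \<in> carrier (profinite_completion G)" for g
  proof (rule extensionalityI[of _ "fin_index_normal G"])
    show "j (k g) \<in> extensional (fin_index_normal G)" by (simp add: j_def profinite_map_def)
    show "g \<in> extensional (fin_index_normal G)" by (rule hatG(1)[OF g])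
    fix M assume M: "M \<in> fin_index_normal G"
    obtain x where x: "x \<in> g M" "x \<in> A" using meet[OF g M] by blast
    have "j (k g) M = M #> x" using jcoset[OF M x(2)] kcoset[OF g pull[OF M] M _ x] by blast
    then show "j (k g) M = g M" using rcosG[OF M hatG(2)[OF g M] x(1)] by simp
  qed
  have "j \<in> hom (profinite_completion \<Gamma>) (profinite_completion G)"
  proof (rule homI)
    show "j f \<in> carrier (profinite_completion G)" if "f \<in> carrier (profinite_completion \<Gamma>)" for f
      by (rule jinto[OF that])
    fix f g assume f: "f \<in> carrier (profinite_completion \<Gamma>)" and g: "g \<in> carrier (profinite_completion \<Gamma>)"
    show "j (f \<otimes>\<^bsub>profinite_completion \<Gamma>\<^esub> g) = j f \<otimes>\<^bsub>profinite_completion G\<^esub> j g"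
    proof (rule extensionalityI[of _ "fin_index_normal G"])
      fix M assume M: "M \<in> fin_index_normal G"
      note N = pull[OF M]
      obtain x y where x: "x \<in> A" "f (A \<inter> M) = (A \<inter> M) #> x"
        and y: "y \<in> A" "g (A \<inter> M) = (A \<inter> M) #> y"
        using nonempty[OF f N] nonempty[OF g N] by blast
      have "f (A \<inter> M) <#> g (A \<inter> M) = (A \<inter> M) #> (x \<otimes> y)"
        using normal.rcos_sum[OF fin_index_normalD(1)[OF N], of x y] x y by (simp add: cosets carrier) (simp add: \<Gamma>_def)
      then have "j (f \<otimes>\<^bsub>profinite_completion \<Gamma>\<^esub> g) M = M #> (x \<otimes> y)"
        using x y M N by (intro jcoset) (auto simp: mult_profinite_completion cosets)
      also have "\<dots> = (M #> x) <#> (M #> y)"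
        using normal.rcos_sum[OF fin_index_normalD(1)[OF M], of x y] x y by simp
      finally show "j (f \<otimes>\<^bsub>profinite_completion \<Gamma>\<^esub> g) M = (j f \<otimes>\<^bsub>profinite_completion G\<^esub> j g) M"
        using M jcoset[where f = f, OF M x] jcoset[where f = g, OF M y] by (simp add: mult_profinite_completion)
    qed (simp_all add: mult_profinite_completion j_def profinite_map_def)
  qed
  moreover have "bij_betw j (carrier (profinite_completion \<Gamma>)) (carrier (profinite_completion G))"
    using jinto kinto jk kj by (intro bij_betwI[of _ _ _ k]) auto
  moreover have "homeomorphic_map (profinite_topology \<Gamma>) (profinite_topology G) j"
  proof (rule homeomorphic_maps_imp_map)
    have "continuous_map (profinite_topology \<Gamma>) (profinite_topology G) j"
    proof (rule continuous_map_into_profinite)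
      fix M assume M: "M \<in> fin_index_normal G"
      have "M <#> C \<in> rcosets M" if "C \<in> rcosets\<^bsub>\<Gamma>\<^esub> (A \<inter> M)" for C
        using that one\<Gamma>[OF pull[OF M]] fin_index_normalD(2)[OF M]
        by (auto simp: RCOSETS_def cosets carrier set_mult_rcoset)
      then show "continuous_map (profinite_topology \<Gamma>) (discrete_topology (rcosets M)) (\<lambda>f. j f M)"
        unfolding jM[OF M] using pull[OF M] by (intro continuous_map_profinite_component) auto
    qed (use jinto in \<open>auto simp: topspace_profinite_topology\<close>)
    moreover have "continuous_map (profinite_topology G) (profinite_topology \<Gamma>) k"
    proof (rule continuous_map_into_profinite)
      fix N assume N: "N \<in> fin_index_normal \<Gamma>"
      have cN: "c N \<in> fin_index_normal G" "A \<inter> c N \<subseteq> N" using c[OF N] by auto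
      have "N <#> (C \<inter> A) \<in> rcosets\<^bsub>\<Gamma>\<^esub> N" if C: "C \<in> rcosets (c N)" for C
      proof -
        obtain x where x: "x \<in> C" "x \<in> A" using C dense[OF cN(1)] by (auto simp: RCOSETS_def)
        have "C \<inter> A = (A \<inter> c N) #> x" using rcosG[OF cN(1) C x(1)] trace[OF cN(1) x(2)] by simp
        moreover have "N <#> ((A \<inter> c N) #> x) = N #> x"
          using cN one\<Gamma>[OF pull] x(2) by (intro set_mult_rcoset sub\<Gamma>[OF N]) auto
        ultimately show ?thesis using rcos\<Gamma>I[OF x(2)] by simp
      qed
      then have "continuous_map (profinite_topology G) (discrete_topology (rcosets\<^bsub>\<Gamma>\<^esub> N))
                   (\<lambda>g. N <#> (g (c N) \<inter> A))"
        using cN(1) by (intro continuous_map_profinite_component) auto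
      then show "continuous_map (profinite_topology G) (discrete_topology (rcosets\<^bsub>\<Gamma>\<^esub> N)) (\<lambda>g. k g N)"
        using N by (simp add: k_def)
    qed (use kinto in \<open>auto simp: topspace_profinite_topology\<close>)
    ultimately show "homeomorphic_maps (profinite_topology \<Gamma>) (profinite_topology G) j k"
      using jk kj by (simp add: homeomorphic_maps_def topspace_profinite_topology)
  qed
  ultimately have "profinite_isomorphism \<Gamma> G j"
    by (simp add: profinite_isomorphism_def iso_def)
  then show ?thesis by (simp add: j_def \<Gamma>_def)
qed

lemma profinite_isomorphism_compose:
  assumes "profinite_isomorphism \<Gamma> \<Delta> \<theta>" "profinite_isomorphism \<Delta> \<Lambda> \<eta>"
  shows "profinite_isomorphism \<Gamma> \<Lambda> (\<eta> \<circ> \<theta>)"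
proof -
  note \<theta> = assms(1)[unfolded profinite_isomorphism_def iso_def]
  note \<eta> = assms(2)[unfolded profinite_isomorphism_def iso_def]
  have "\<eta> \<circ> \<theta> \<in> hom (profinite_completion \<Gamma>) (profinite_completion \<Lambda>)"
    by (rule Group.hom_compose[of _ _ "profinite_completion \<Delta>"]) (use \<theta> \<eta> in simp_all)
  moreover have "bij_betw (\<eta> \<circ> \<theta>) (carrier (profinite_completion \<Gamma>)) (carrier (profinite_completion \<Lambda>))"
    by (rule bij_betw_trans[of _ _ "carrier (profinite_completion \<Delta>)"]) (use \<theta> \<eta> in simp_all)
  moreover have "homeomorphic_map (profinite_topology \<Gamma>) (profinite_topology \<Lambda>) (\<eta> \<circ> \<theta>)"
    by (rule homeomorphic_map_compose[of _ "profinite_topology \<Delta>"]) (use \<theta> \<eta> in simp_all)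
  ultimately show ?thesis by (simp add: profinite_isomorphism_def iso_def)
qed

text \<open>
  The inverse of a bijective homomorphism is a homomorphism once products in its domain stay
  in the carrier; this is all that is needed about \<open>profinite_completion\<close> in order to invert
  isomorphisms.
\<close>

lemma (in group) profinite_completion_mult_closed:
  assumes "f \<in> carrier (profinite_completion G)" "g \<in> carrier (profinite_completion G)"
  shows "f \<otimes>\<^bsub>profinite_completion G\<^esub> g \<in> carrier (profinite_completion G)"
  unfolding carrier_profinite_completion
proof (intro conjI ballI impI)
  note f = assms(1)[unfolded carrier_profinite_completion]
  note g = assms(2)[unfolded carrier_profinite_completion]
  show "f \<otimes>\<^bsub>profinite_completion G\<^esub> g \<in> extensional (fin_index_normal G)"
    by (simp add: mult_profinite_completion)
  show "(f \<otimes>\<^bsub>profinite_completion G\<^esub> g) N \<in> rcosets N" if "N \<in> fin_index_normal G" for N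
    using f g normal.setmult_closed[OF fin_index_normalD(1)[OF that]] that
    by (simp add: mult_profinite_completion)
  show "(f \<otimes>\<^bsub>profinite_completion G\<^esub> g) N \<subseteq> (f \<otimes>\<^bsub>profinite_completion G\<^esub> g) M"
    if "N \<in> fin_index_normal G" "M \<in> fin_index_normal G" "N \<subseteq> M" for N M
    using f g that by (simp add: mult_profinite_completion mono_set_mult)
qed

lemma (in group) profinite_isomorphism_inverse:
  assumes "profinite_isomorphism G \<Delta> \<theta>"
  shows "\<exists>\<eta>. profinite_isomorphism \<Delta> G \<eta>"
proof -
  let ?PG = "profinite_completion G"
  let ?\<eta> = "inv_into (carrier ?PG) \<theta>"
  have iso: "\<theta> \<in> iso ?PG (profinite_completion \<Delta>)"
    and homeo: "homeomorphic_map (profinite_topology G) (profinite_topology \<Delta>) \<theta>"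
    using assms by (auto simp: profinite_isomorphism_def)
  have bij: "bij_betw \<theta> (carrier ?PG) (carrier (profinite_completion \<Delta>))"
    and hom: "\<theta> \<in> hom ?PG (profinite_completion \<Delta>)"
    using iso by (auto simp: iso_def)
  have "?\<eta> \<in> hom (profinite_completion \<Delta>) ?PG"
  proof (rule homI)
    show "?\<eta> x \<in> carrier ?PG" if "x \<in> carrier (profinite_completion \<Delta>)" for x
      using that bij by (metis bij_betw_def inv_into_into)
    fix x y assume xy: "x \<in> carrier (profinite_completion \<Delta>)" "y \<in> carrier (profinite_completion \<Delta>)"
    then have "x \<in> \<theta> ` carrier ?PG" "y \<in> \<theta> ` carrier ?PG"
      using bij by (simp_all add: bij_betw_def)
    then obtain a b where ab: "a \<in> carrier ?PG" "b \<in> carrier ?PG" "x = \<theta> a" "y = \<theta> b"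
      by blast
    then have "x \<otimes>\<^bsub>profinite_completion \<Delta>\<^esub> y = \<theta> (a \<otimes>\<^bsub>?PG\<^esub> b)"
      using hom by (simp add: hom_mult)
    then show "?\<eta> (x \<otimes>\<^bsub>profinite_completion \<Delta>\<^esub> y) = ?\<eta> x \<otimes>\<^bsub>?PG\<^esub> ?\<eta> y"
      using ab bij by (simp add: bij_betw_def profinite_completion_mult_closed)
  qed
  moreover have "bij_betw ?\<eta> (carrier (profinite_completion \<Delta>)) (carrier ?PG)"
    using bij by (rule bij_betw_inv_into)
  moreover have "homeomorphic_map (profinite_topology \<Delta>) (profinite_topology G) ?\<eta>"
  proof -
    obtain \<psi> where \<psi>: "homeomorphic_maps (profinite_topology G) (profinite_topology \<Delta>) \<theta> \<psi>"
      using homeo homeomorphic_map_maps by blast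
    have "\<psi> y = ?\<eta> y" if "y \<in> topspace (profinite_topology \<Delta>)" for y
    proof -
      have "\<psi> y \<in> carrier ?PG" "\<theta> (\<psi> y) = y"
        using \<psi> that by (auto simp: homeomorphic_maps_def continuous_map_def topspace_profinite_topology)
      then show ?thesis using bij by (metis bij_betw_def inv_into_f_f)
    qed
    moreover have "homeomorphic_map (profinite_topology \<Delta>) (profinite_topology G) \<psi>"
      using \<psi> homeomorphic_maps_map homeomorphic_maps_sym by blast
    ultimately show ?thesis using homeomorphic_map_eq by metis
  qed
  ultimately have "profinite_isomorphism \<Delta> G ?\<eta>"
    by (simp add: profinite_isomorphism_def iso_def)
  then show ?thesis by blast
qed

section \<open>Subgroups, homomorphisms and perfect groups\<close>

lemma (in group) subgroup_cancel_right:
  assumes "subgroup K G" "a \<in> carrier G" "b \<in> K" "a \<otimes> b \<in> K"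
  shows "a \<in> K"
proof -
  have "b \<in> carrier G" using assms(1,3) by (rule subgroup.mem_carrier)
  then have "a = (a \<otimes> b) \<otimes> inv b" using assms(2) by (simp add: m_assoc)
  then show ?thesis using assms by (metis subgroup.m_closed subgroup.m_inv_closed)
qed

lemma subgroup_hom_vimage:
  assumes "group G" "group H" "\<phi> \<in> hom G H" "subgroup N H"
  shows "subgroup {x \<in> carrier G. \<phi> x \<in> N} G"
proof -
  interpret group_hom G H \<phi> using assms(1-3) by (simp add: group_hom_def group_hom_axioms_def)
  interpret N: subgroup N H by fact
  show ?thesis by (rule G.subgroupI) auto
qed

text \<open>
  The form in which perfectness is used throughout: the preimage of a subgroup is a
  subgroup, so it contains a perfect group as soon as it contains its commutators.
\<close>

lemma perfect_hom_into_subgroup: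
  assumes "group G" "group H" "\<phi> \<in> hom G H" "subgroup N H"
    and "perfect_subgroup G K" "K \<subseteq> carrier G"
    and "\<And>a b. a \<in> K \<Longrightarrow> b \<in> K \<Longrightarrow> \<phi> (a \<otimes>\<^bsub>G\<^esub> b \<otimes>\<^bsub>G\<^esub> inv\<^bsub>G\<^esub> a \<otimes>\<^bsub>G\<^esub> inv\<^bsub>G\<^esub> b) \<in> N"
    and "a \<in> K"
  shows "\<phi> a \<in> N"
proof -
  interpret group G by fact
  have "derived_set G K \<subseteq> {x \<in> carrier G. \<phi> x \<in> N}"
    using assms(6,7) by (auto simp: subset_iff)
  then have "derived G K \<subseteq> {x \<in> carrier G. \<phi> x \<in> N}"
    unfolding derived_def
    by (rule generate_subgroup_incl) (rule subgroup_hom_vimage[OF assms(1-4)])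
  then show ?thesis using assms(5,8) by (auto simp: perfect_subgroup_def)
qed

text \<open>
  With \<open>d = \<alpha> a\<inverse> \<alpha>\<inverse>\<close> the product \<open>a d\<close> is the commutator of \<open>a\<close> and \<open>\<alpha>\<close>: if the conjugate \<open>d\<close>
  commutes with \<open>b\<close>, taking the commutator with \<open>b\<close> makes \<open>\<alpha>\<close> disappear.
\<close>

lemma (in group) commutator_of_commutator:
  assumes "a \<in> carrier G" "b \<in> carrier G" "d \<in> carrier G" "d \<otimes> b = b \<otimes> d"
  shows "(a \<otimes> d) \<otimes> b \<otimes> inv (a \<otimes> d) \<otimes> inv b = a \<otimes> b \<otimes> inv a \<otimes> inv b"
proof -
  have "(a \<otimes> d) \<otimes> b \<otimes> inv (a \<otimes> d) = a \<otimes> (d \<otimes> b) \<otimes> inv d \<otimes> inv a"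
    using assms(1-3) by (simp add: m_assoc inv_mult_group)
  also have "\<dots> = a \<otimes> b \<otimes> inv a"
    unfolding assms(4) using assms(1-3) by (simp add: m_assoc inv_solve_right')
  finally show ?thesis by simp
qed

section \<open>Tree automorphisms through their action on letters and their states\<close>

interpretation T: group tree_aut by (rule tree_aut_group)

lemma tree_aut_mult [simp]: "\<alpha> \<otimes>\<^bsub>tree_aut\<^esub> \<beta> = \<alpha> \<circ> \<beta>"
  and tree_aut_one [simp]: "\<one>\<^bsub>tree_aut\<^esub> = id"
  by (simp_all add: tree_aut_def)

abbreviation tree_inv :: "('a list \<Rightarrow> 'a list) \<Rightarrow> 'a list \<Rightarrow> 'a list" where
  "tree_inv \<alpha> \<equiv> inv\<^bsub>tree_aut\<^esub> \<alpha>"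

lemma tree_aut_bij: "\<alpha> \<in> carrier tree_aut \<Longrightarrow> bij \<alpha>"
  by (simp add: tree_aut_def)

lemma tree_aut_inv_apply [simp]:
  assumes "\<alpha> \<in> carrier tree_aut"
  shows "tree_inv \<alpha> (\<alpha> w) = w" "\<alpha> (tree_inv \<alpha> w) = w"
  using T.l_inv[OF assms] T.r_inv[OF assms] by (simp_all add: fun_eq_iff)

lemma tree_aut_inv_comp [simp]:
  assumes "\<alpha> \<in> carrier tree_aut"
  shows "tree_inv \<alpha> \<circ> \<alpha> = id" "\<alpha> \<circ> tree_inv \<alpha> = id"
  using T.l_inv[OF assms] T.r_inv[OF assms] by simp_all

lemma tree_aut_comp_closed:
  "\<alpha> \<in> carrier tree_aut \<Longrightarrow> \<beta> \<in> carrier tree_aut \<Longrightarrow> \<alpha> \<circ> \<beta> \<in> carrier tree_aut"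
  using T.m_closed[of \<alpha> \<beta>] by simp

lemma tree_aut_length: "\<alpha> \<in> carrier tree_aut \<Longrightarrow> length (\<alpha> w) = length w"
  by (rule tree_aut_length_snoc[THEN conjunct1])

lemma tree_aut_take:
  assumes "\<alpha> \<in> carrier tree_aut"
  shows "take n (\<alpha> w) = \<alpha> (take n w)"
proof (induction w rule: rev_induct)
  case Nil
  then show ?case using tree_aut_length[OF assms, of "[]"] by simp
next
  case (snoc x w)
  obtain y where "\<alpha> (w @ [x]) = \<alpha> w @ [y]"
    using tree_aut_length_snoc[OF assms, of w x] by blast
  then show ?case using snoc tree_aut_length[OF assms, of w] tree_aut_length[OF assms, of "w @ [x]"]
    by (cases "n \<le> length w") auto
qed

text \<open>
  The automorphism with prescribed action on letters and prescribed states. Equations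
  between tree automorphisms are checked below by writing both sides in this form and
  comparing letter by letter.
\<close>

fun wreath :: "('a \<Rightarrow> 'a) \<Rightarrow> ('a \<Rightarrow> 'a list \<Rightarrow> 'a list) \<Rightarrow> 'a list \<Rightarrow> 'a list" where
  "wreath \<sigma> \<gamma> [] = []"
| "wreath \<sigma> \<gamma> (x # w) = \<sigma> x # \<gamma> x w"

lemma wreath_comp: "wreath \<sigma> \<gamma> \<circ> wreath \<tau> \<delta> = wreath (\<sigma> \<circ> \<tau>) (\<lambda>x. \<gamma> (\<tau> x) \<circ> \<delta> x)"
proof
  show "(wreath \<sigma> \<gamma> \<circ> wreath \<tau> \<delta>) w = wreath (\<sigma> \<circ> \<tau>) (\<lambda>x. \<gamma> (\<tau> x) \<circ> \<delta> x) w" for w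
    by (cases w) auto
qed

lemma wreath_id [simp]: "wreath id (\<lambda>x. id) = id"
proof
  show "wreath id (\<lambda>x. id) w = id w" for w :: "'a list" by (cases w) auto
qed

lemma level_perm_wreath [simp]: "level_perm (wreath \<sigma> \<gamma>) = \<sigma>"
  and state_wreath [simp]: "state (wreath \<sigma> \<gamma>) = \<gamma>"
  by (auto simp: level_perm_def state_def fun_eq_iff)

lemma level_perm_id [simp]: "level_perm id = id"
  and state_id [simp]: "state id x = id"
  by (auto simp: level_perm_def state_def fun_eq_iff)

lemma wreath_level_perm_state:
  assumes "\<alpha> \<in> carrier tree_aut"
  shows "wreath (level_perm \<alpha>) (state \<alpha>) = \<alpha>"
proof
  show "wreath (level_perm \<alpha>) (state \<alpha>) w = \<alpha> w" for w
    using assms tree_aut_Cons[OF assms] by (cases w) (auto simp: tree_aut_def)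
qed

lemma tree_adj_Cons: "tree_adj (x # v) (y # w) \<longleftrightarrow> x = y \<and> tree_adj v w"
  and tree_adj_Nil: "tree_adj [] w \<longleftrightarrow> length w = 1" "tree_adj w [] \<longleftrightarrow> length w = 1"
  by (auto simp: tree_adj_def length_Suc_conv)

lemma wreath_in_tree_aut:
  assumes "bij \<sigma>" "\<And>x. \<gamma> x \<in> carrier tree_aut"
  shows "wreath \<sigma> \<gamma> \<in> carrier tree_aut"
proof -
  let ?\<tau> = "inv_into UNIV \<sigma>"
  have "wreath \<sigma> \<gamma> \<circ> wreath ?\<tau> (\<lambda>x. tree_inv (\<gamma> (?\<tau> x))) = id"
    using assms by (simp add: wreath_comp surj_iff[THEN iffD1] bij_is_surj)
  moreover have "wreath ?\<tau> (\<lambda>x. tree_inv (\<gamma> (?\<tau> x))) \<circ> wreath \<sigma> \<gamma> = id"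
    using assms by (simp add: wreath_comp inj_iff[THEN iffD1] bij_is_inj)
  ultimately have "bij (wreath \<sigma> \<gamma>)" using o_bij by blast
  moreover have "tree_adj (wreath \<sigma> \<gamma> v) (wreath \<sigma> \<gamma> w) \<longleftrightarrow> tree_adj v w" for v w
    using assms tree_aut_length[OF assms(2)]
    by (cases v; cases w) (auto simp: tree_adj_Cons tree_adj_Nil bij_is_inj inj_eq tree_aut_def)
  ultimately show ?thesis by (simp add: tree_aut_def)
qed

lemma level_perm_bij:
  assumes "\<alpha> \<in> carrier tree_aut"
  shows "bij (level_perm \<alpha>)"
proof -
  have one: "\<alpha> [x] = [level_perm \<alpha> x]" for x
    using tree_aut_Cons[OF assms, of x "[]"] tree_aut_length[OF assms, of "[x]"] by simp
  have "inj (level_perm \<alpha>)"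
  proof
    fix x y assume "level_perm \<alpha> x = level_perm \<alpha> y"
    then have "\<alpha> [x] = \<alpha> [y]" by (simp add: one)
    then show "x = y" using tree_aut_bij[OF assms] by (simp add: bij_is_inj inj_eq)
  qed
  moreover have "\<exists>x. y = level_perm \<alpha> x" for y
  proof -
    obtain w where w: "\<alpha> w = [y]" using tree_aut_bij[OF assms] by (metis bij_pointE)
    then have "length w = 1" using tree_aut_length[OF assms, of w] by simp
    then obtain x where "w = [x]" by (auto simp: length_Suc_conv)
    then show ?thesis using w one by auto
  qed
  ultimately show ?thesis by (auto simp: bij_def surj_def)
qed

lemma level_perm_eq_iff:
  "\<alpha> \<in> carrier tree_aut \<Longrightarrow> level_perm \<alpha> x = level_perm \<alpha> y \<longleftrightarrow> x = y"
  by (metis level_perm_bij bij_is_inj inj_eq)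

lemma state_in_tree_aut:
  assumes "\<alpha> \<in> carrier tree_aut"
  shows "state \<alpha> x \<in> carrier tree_aut"
proof -
  have inj: "inj \<alpha>" using tree_aut_bij[OF assms] by (rule bij_is_inj)
  have "inj (state \<alpha> x)"
  proof
    fix v w assume "state \<alpha> x v = state \<alpha> x w"
    then have "\<alpha> (x # v) = \<alpha> (x # w)" using tree_aut_Cons[OF assms] by simp
    then show "v = w" using inj by (simp add: inj_eq)
  qed
  moreover have "\<exists>v. w = state \<alpha> x v" for w
  proof -
    obtain u where u: "\<alpha> u = level_perm \<alpha> x # w" using tree_aut_bij[OF assms] by (metis bij_pointE)
    then obtain y v where v: "u = y # v" using tree_aut_length[OF assms, of u] by (cases u) auto
    then show ?thesis using u tree_aut_Cons[OF assms, of y v] level_perm_eq_iff[OF assms] by auto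
  qed
  moreover have "tree_adj (state \<alpha> x v) (state \<alpha> x w) \<longleftrightarrow> tree_adj v w" for v w
  proof -
    have "tree_adj (state \<alpha> x v) (state \<alpha> x w) \<longleftrightarrow> tree_adj (\<alpha> (x # v)) (\<alpha> (x # w))"
      by (simp add: tree_aut_Cons[OF assms] tree_adj_Cons)
    also have "\<dots> \<longleftrightarrow> tree_adj v w"
      using assms by (simp add: tree_aut_def tree_adj_Cons)
    finally show ?thesis .
  qed
  moreover have "state \<alpha> x [] = []"
    using tree_aut_length[OF assms, of "[x]"] by (cases "\<alpha> [x]") (auto simp: state_def)
  ultimately show ?thesis by (auto simp: tree_aut_def bij_def surj_def)
qed

lemma
  assumes "\<alpha> \<in> carrier tree_aut" "\<beta> \<in> carrier tree_aut"
  shows level_perm_comp: "level_perm (\<alpha> \<circ> \<beta>) = level_perm \<alpha> \<circ> level_perm \<beta>"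
    and state_comp: "state (\<alpha> \<circ> \<beta>) x = state \<alpha> (level_perm \<beta> x) \<circ> state \<beta> x"
proof -
  have "\<alpha> \<circ> \<beta> = wreath (level_perm \<alpha>) (state \<alpha>) \<circ> wreath (level_perm \<beta>) (state \<beta>)"
    using assms by (simp add: wreath_level_perm_state)
  then have *: "\<alpha> \<circ> \<beta> = wreath (level_perm \<alpha> \<circ> level_perm \<beta>)
                    (\<lambda>x. state \<alpha> (level_perm \<beta> x) \<circ> state \<beta> x)"
    by (simp add: wreath_comp)
  show "level_perm (\<alpha> \<circ> \<beta>) = level_perm \<alpha> \<circ> level_perm \<beta>"
    "state (\<alpha> \<circ> \<beta>) x = state \<alpha> (level_perm \<beta> x) \<circ> state \<beta> x"
    by (simp_all only: * level_perm_wreath state_wreath)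
qed

lemma level_perm_inv:
  assumes "\<alpha> \<in> carrier tree_aut"
  shows "level_perm (tree_inv \<alpha>) = inv_into UNIV (level_perm \<alpha>)"
proof -
  have "level_perm \<alpha> \<circ> level_perm (tree_inv \<alpha>) = id"
    using level_perm_comp[OF assms T.inv_closed[OF assms]] T.r_inv[OF assms] by simp
  then show ?thesis
    by (metis assms level_perm_bij bij_is_inj inj_iff comp_assoc comp_id id_comp)
qed

lemma state_inv:
  assumes "\<alpha> \<in> carrier tree_aut"
  shows "state (tree_inv \<alpha>) (level_perm \<alpha> x) = tree_inv (state \<alpha> x)"
proof -
  have "state (tree_inv \<alpha>) (level_perm \<alpha> x) \<circ> state \<alpha> x = id"
    using state_comp[OF T.inv_closed[OF assms] assms, of x] T.l_inv[OF assms] by simp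
  then show ?thesis
    using T.inv_equality[of "state (tree_inv \<alpha>) (level_perm \<alpha> x)" "state \<alpha> x"]
      state_in_tree_aut[OF T.inv_closed[OF assms]] state_in_tree_aut[OF assms] by simp
qed

lemma subgroup_wreath_product:
  assumes "subgroup G tree_aut" "subgroup K tree_aut"
  shows "subgroup {\<alpha> \<in> carrier tree_aut. level_perm \<alpha> \<in> level_perm ` G \<and> (\<forall>x. state \<alpha> x \<in> K)} tree_aut"
    (is "subgroup ?W _")
proof (rule T.subgroupI)
  interpret G: subgroup G tree_aut by fact
  interpret K: subgroup K tree_aut by fact
  have "id \<in> ?W"
    using G.one_closed K.one_closed T.one_closed by (force simp: image_iff)
  then show "?W \<noteq> {}" by blast
  fix \<alpha> assume \<alpha>: "\<alpha> \<in> ?W"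
  then obtain g where g: "g \<in> G" "level_perm \<alpha> = level_perm g" by blast
  have "level_perm (tree_inv \<alpha>) = level_perm (tree_inv g)"
    using \<alpha> g G.mem_carrier by (simp add: level_perm_inv)
  moreover have "state (tree_inv \<alpha>) y \<in> K" for y
  proof -
    obtain x where "y = level_perm \<alpha> x" using \<alpha> level_perm_bij by (metis (lifting) CollectD bij_pointE)
    then show ?thesis using \<alpha> by (simp add: state_inv)
  qed
  ultimately show "tree_inv \<alpha> \<in> ?W" using \<alpha> g by (auto intro!: image_eqI)
  fix \<beta> assume \<beta>: "\<beta> \<in> ?W"
  then obtain h where h: "h \<in> G" "level_perm \<beta> = level_perm h" by blast
  have "level_perm (\<alpha> \<circ> \<beta>) = level_perm (g \<circ> h)"
    using \<alpha> \<beta> g h G.mem_carrier by (simp add: level_perm_comp)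
  moreover have "g \<circ> h \<in> G" using G.m_closed[OF g(1) h(1)] by simp
  moreover have "state (\<alpha> \<circ> \<beta>) x \<in> K" for x
    using \<alpha> \<beta> K.m_closed by (simp add: state_comp)
  moreover have "\<alpha> \<circ> \<beta> \<in> carrier tree_aut" using \<alpha> \<beta> by (simp add: tree_aut_comp_closed)
  ultimately show "\<alpha> \<otimes>\<^bsub>tree_aut\<^esub> \<beta> \<in> ?W" by auto
qed auto

section \<open>Automorphisms supported on a subtree\<close>

text \<open>
  The copy of \<open>\<alpha>\<close> acting on the subtree below a letter, or below a vertex, and trivially
  elsewhere.
\<close>

definition place :: "'a \<Rightarrow> ('a list \<Rightarrow> 'a list) \<Rightarrow> 'a list \<Rightarrow> 'a list" where
  "place x \<alpha> = wreath id (\<lambda>y. if y = x then \<alpha> else id)"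

primrec place_at :: "'a list \<Rightarrow> ('a list \<Rightarrow> 'a list) \<Rightarrow> 'a list \<Rightarrow> 'a list" where
  "place_at [] \<alpha> = \<alpha>"
| "place_at (x # v) \<alpha> = place x (place_at v \<alpha>)"

lemma place_hom: "place x \<in> hom tree_aut tree_aut"
proof (rule homI)
  show "place x \<alpha> \<in> carrier tree_aut" if "\<alpha> \<in> carrier tree_aut" for \<alpha>
    unfolding place_def using that T.one_closed by (intro wreath_in_tree_aut) auto
qed (auto simp: place_def wreath_comp intro!: arg_cong[of _ _ "wreath id"])

lemma place_at_hom: "place_at v \<in> hom tree_aut tree_aut"
proof (induction v)
  case Nil
  then show ?case by (simp add: hom_def)
next
  case (Cons x v)
  have "place_at (x # v) = place x \<circ> place_at v" by (simp add: fun_eq_iff)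
  then show ?case using hom_compose[OF Cons place_hom] by metis
qed

lemma place_at_support: "place_at v \<beta> u \<noteq> u \<Longrightarrow> take (length v) u = v"
proof (induction v arbitrary: u)
  case (Cons x v)
  then show ?case by (cases u) (auto simp: place_def split: if_splits)
qed simp

text \<open>
  The conjugation rule for copies below a letter. It is stated without inverses so that both
  sides can be compared letter by letter.
\<close>

lemma place_conj:
  assumes "k \<in> carrier tree_aut" "state k x \<circ> \<beta> = \<beta>' \<circ> state k x"
  shows "k \<circ> place x \<beta> = place (level_perm k x) \<beta>' \<circ> k"
proof -
  let ?k = "wreath (level_perm k) (state k)"
  have "?k \<circ> place x \<beta> = place (level_perm k x) \<beta>' \<circ> ?k"
    unfolding place_def wreath_comp
    using assms(2) by (intro arg_cong2[of _ _ _ _ wreath]) (auto simp: level_perm_eq_iff[OF assms(1)])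
  then show ?thesis by (simp add: wreath_level_perm_state[OF assms(1)])
qed

text \<open>
  Conjugation by \<open>k\<close> moves copies below \<open>x\<close> to copies below \<open>level_perm k x\<close> and twists them by the
  state of \<open>k\<close> at \<open>x\<close>; the twist does no harm when it comes from \<open>B\<close> itself.
\<close>

lemma place_transport:
  assumes K: "subgroup K tree_aut" "k \<in> K"
    and B: "subgroup B tree_aut" "state k x \<in> B"
    and "\<And>\<beta>. \<beta> \<in> B \<Longrightarrow> place x \<beta> \<in> K" "\<beta> \<in> B"
  shows "place (level_perm k x) \<beta> \<in> K"
proof -
  interpret K: subgroup K tree_aut by fact
  interpret B: subgroup B tree_aut by fact
  let ?s = "state k x"
  let ?\<beta> = "tree_inv ?s \<circ> \<beta> \<circ> ?s"
  have "?\<beta> \<in> B" using B.m_closed B.m_inv_closed B(2) assms(6) by (metis tree_aut_mult)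
  then have "k \<circ> place x ?\<beta> \<in> K" using assms(5) K.m_closed K(2) by (metis tree_aut_mult)
  moreover have "?s \<circ> ?\<beta> = \<beta> \<circ> ?s"
    using B(2) B.mem_carrier by (auto simp: fun_eq_iff)
  then have "k \<circ> place x ?\<beta> = place (level_perm k x) \<beta> \<circ> k"
    using K by (intro place_conj) auto
  ultimately show ?thesis
    using T.subgroup_cancel_right[OF K(1) _ K(2)] place_hom assms(6) B.mem_carrier
    by (metis hom_in_carrier tree_aut_mult)
qed

text \<open>
  An automorphism fixing all letters is the product of its pieces below the finitely many
  letters.
\<close>

lemma wreath_id_in_subgroup:
  fixes \<gamma> :: "'a :: finite \<Rightarrow> 'a list \<Rightarrow> 'a list"
  assumes "subgroup K tree_aut" "\<And>x. place x (\<gamma> x) \<in> K"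
  shows "wreath id \<gamma> \<in> K"
proof -
  interpret K: subgroup K tree_aut by fact
  have "wreath id (\<lambda>x. if x \<in> Y then \<gamma> x else id) \<in> K" if "finite Y" for Y
    using that
  proof (induction Y)
    case empty
    then show ?case using K.one_closed by (simp only: empty_iff if_False wreath_id tree_aut_one)
  next
    case (insert y Y)
    have "wreath id (\<lambda>x. if x \<in> insert y Y then \<gamma> x else id)
        = place y (\<gamma> y) \<circ> wreath id (\<lambda>x. if x \<in> Y then \<gamma> x else id)"
      unfolding place_def wreath_comp using insert(2)
      by (intro arg_cong2[of _ _ _ _ wreath]) auto
    then show ?case using K.m_closed[OF assms(2)[of y] insert(3)] by (simp only: tree_aut_mult)
  qed
  from this[of UNIV] show ?thesis by simp
qed

lemma directed_aut_wreath:
  "directed_aut p \<alpha> \<omega> =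
     wreath id (\<lambda>x. if x = p then directed_aut p \<alpha> (seq_shift \<omega>) else if x = \<omega> 0 then \<alpha> else id)"
proof
  fix w
  show "directed_aut p \<alpha> \<omega> w =
     wreath id (\<lambda>x. if x = p then directed_aut p \<alpha> (seq_shift \<omega>) else if x = \<omega> 0 then \<alpha> else id) w"
    by (cases w) (auto simp: directed_aut_def)
qed

text \<open>
  The directed automorphisms of the elements of a group along one sequence form a
  homomorphic image of it. If the group is perfect, so is this image, which is why the group
  generated by \<open>G\<close> and its directed automorphisms is perfect.
\<close>

lemma directed_aut_hom: "(\<lambda>\<alpha>. directed_aut p \<alpha> \<omega>) \<in> hom tree_aut tree_aut"
proof (rule homI)
  have "directed p (\<alpha> \<circ> \<beta>) w \<omega> = directed p \<alpha> (directed p \<beta> w \<omega>) \<omega>" for \<alpha> \<beta> :: "'a list \<Rightarrow> 'a list" and w \<omega>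
    by (induction w arbitrary: \<omega>) auto
  then show "directed_aut p (\<alpha> \<otimes>\<^bsub>tree_aut\<^esub> \<beta>) \<omega> = directed_aut p \<alpha> \<omega> \<otimes>\<^bsub>tree_aut\<^esub> directed_aut p \<beta> \<omega>"
    for \<alpha> \<beta> by (simp add: directed_aut_def fun_eq_iff)
qed (rule directed_aut_in_tree_aut)

lemma disjoint_supports_commute:
  assumes "\<And>u. f u \<noteq> u \<Longrightarrow> P u" "\<And>u. g u \<noteq> u \<Longrightarrow> \<not> P u" "inj f" "inj g"
  shows "f \<circ> g = g \<circ> f"
proof
  fix u
  show "(f \<circ> g) u = (g \<circ> f) u"
  proof (cases "P u")
    case True
    have "P (f u)" using True assms(1)[of "f u"] assms(3) by (metis inj_eq)
    then have "g (f u) = f u" using assms(2) by blast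
    moreover have "g u = u" using True assms(2) by blast
    ultimately show ?thesis by simp
  next
    case False
    have "\<not> P (g u)" using False assms(2)[of "g u"] assms(4) by (metis inj_eq)
    then have "f (g u) = g u" using assms(1) by blast
    moreover have "f u = u" using False assms(1) by blast
    ultimately show ?thesis by simp
  qed
qed

section \<open>Level stabilisers\<close>

definition level_stab :: "nat \<Rightarrow> ('a list \<Rightarrow> 'a list) set" where
  "level_stab n = {\<alpha> \<in> carrier tree_aut. \<forall>w. length w = n \<longrightarrow> \<alpha> w = w}"

lemma level_stab_quotient:
  assumes "\<alpha> \<in> carrier tree_aut" "\<beta> \<in> carrier tree_aut" "\<And>w. length w = n \<Longrightarrow> \<alpha> w = \<beta> w"
  shows "\<alpha> \<circ> tree_inv \<beta> \<in> level_stab n"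
proof -
  have "\<alpha> (tree_inv \<beta> w) = w" if "length w = n" for w
  proof -
    have "length (tree_inv \<beta> w) = n"
      using tree_aut_length[OF T.inv_closed[OF assms(2)]] that by simp
    then show ?thesis using assms(2,3) by simp
  qed
  then show ?thesis
    using assms(1,2) by (simp add: level_stab_def tree_aut_comp_closed)
qed

lemma level_stab_subgroup: "subgroup (level_stab n) tree_aut"
proof (rule T.subgroupI)
  show "level_stab n \<noteq> {}" using T.one_closed by (auto simp: level_stab_def)
  show "tree_inv \<alpha> \<in> level_stab n" if "\<alpha> \<in> level_stab n" for \<alpha>
    using level_stab_quotient[of id \<alpha> n] T.one_closed that by (simp add: level_stab_def)
qed (auto simp: level_stab_def tree_aut_comp_closed)

text \<open>
  The level is finite, so only finitely many permutations of it occur. Through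
  \<open>fin_index_normal_restrict\<close> this provides finite index normal subgroups of all the groups
  considered below.
\<close>

lemma level_stab_fin_index_normal:
  "level_stab n \<in> fin_index_normal (tree_aut :: ('a :: finite list \<Rightarrow> 'a list) monoid)"
proof -
  let ?N = "level_stab n :: ('a list \<Rightarrow> 'a list) set"
  have "?N \<lhd> tree_aut"
    unfolding T.normal_inv_iff
  proof (intro conjI ballI level_stab_subgroup)
    fix \<gamma> \<nu> :: "'a list \<Rightarrow> 'a list" assume \<gamma>: "\<gamma> \<in> carrier tree_aut" and \<nu>: "\<nu> \<in> ?N"
    then have "\<gamma> \<circ> \<nu> \<in> carrier tree_aut" by (simp add: tree_aut_comp_closed level_stab_def)
    from level_stab_quotient[OF this \<gamma>, of n] \<nu>
    show "\<gamma> \<otimes>\<^bsub>tree_aut\<^esub> \<nu> \<otimes>\<^bsub>tree_aut\<^esub> tree_inv \<gamma> \<in> ?N" by (simp add: level_stab_def)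
  qed
  moreover have "finite ((\<lambda>\<alpha>. ?N #>\<^bsub>tree_aut\<^esub> \<alpha>) ` carrier tree_aut)"
  proof (rule finite_image_if_factors)
    let ?L = "{w :: 'a list. length w = n}"
    have "finite ?L" using finite_lists_length_eq[of "UNIV :: 'a set" n] by simp
    then have "finite (?L \<rightarrow>\<^sub>E ?L)" by (intro finite_PiE) auto
    then show "finite ((\<lambda>\<alpha>. restrict \<alpha> ?L) ` carrier tree_aut)"
      by (rule finite_subset[rotated]) (intro image_subsetI restrict_PiE_iff[THEN iffD2] ballI, simp add: tree_aut_length)
    fix \<alpha> \<beta> :: "'a list \<Rightarrow> 'a list"
    assume \<alpha>\<beta>: "\<alpha> \<in> carrier tree_aut" "\<beta> \<in> carrier tree_aut" "restrict \<alpha> ?L = restrict \<beta> ?L"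
    have "\<alpha> w = \<beta> w" if "length w = n" for w using fun_cong[OF \<alpha>\<beta>(3), of w] that by simp
    then have "\<alpha> \<circ> tree_inv \<beta> \<in> ?N" using \<alpha>\<beta>(1,2) by (intro level_stab_quotient)
    then show "?N #>\<^bsub>tree_aut\<^esub> \<alpha> = ?N #>\<^bsub>tree_aut\<^esub> \<beta>"
      using T.rcoset_eq_iff[OF level_stab_subgroup \<alpha>\<beta>(1,2)] by simp
  qed
  ultimately show ?thesis by (simp add: fin_index_normal_def carrier_FactGroup)
qed

section \<open>The wreath recursion for groups generated by directed automorphisms\<close>

locale perfect_self_similar =
  fixes G :: "('a :: finite list \<Rightarrow> 'a list) set"
  assumes subgroup: "subgroup G tree_aut"
    and perfect: "perfect_subgroup tree_aut G"
    and self_similar: "self_similar G"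
    and property_H: "property_H G"
begin

abbreviation \<Gamma> :: "'a \<Rightarrow> (nat \<Rightarrow> 'a) set \<Rightarrow> ('a list \<Rightarrow> 'a list) set" where
  "\<Gamma> p \<Omega> \<equiv> carrier (Gamma_group p G \<Omega>)"

sublocale G: subgroup G tree_aut by (rule subgroup)

lemma state_in: "g \<in> G \<Longrightarrow> state g x \<in> G"
  using self_similar by (simp add: self_similar_def)

lemma transitive: "\<exists>g\<in>G. level_perm g x = y"
  using property_H by (simp add: property_H_def)

lemma generators_in_tree_aut:
  "G \<union> {directed_aut p g \<omega> |g \<omega>. g \<in> G \<and> \<omega> \<in> \<Omega>} \<subseteq> carrier tree_aut"
  by (auto intro: directed_aut_in_tree_aut)

lemma \<Gamma>_eq: "\<Gamma> p \<Omega> = generate tree_aut (G \<union> {directed_aut p g \<omega> |g \<omega>. g \<in> G \<and> \<omega> \<in> \<Omega>})"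
  using generators_in_tree_aut[of p \<Omega>]
  by (simp add: Gamma_group_def carrier_subgroup_generated Int_absorb1)

lemma subgroup_\<Gamma>: "subgroup (\<Gamma> p \<Omega>) tree_aut"
  unfolding \<Gamma>_eq by (rule T.generate_is_subgroup[OF generators_in_tree_aut])

lemma G_in_\<Gamma>: "g \<in> G \<Longrightarrow> g \<in> \<Gamma> p \<Omega>"
  and directed_in_\<Gamma>: "g \<in> G \<Longrightarrow> \<omega> \<in> \<Omega> \<Longrightarrow> directed_aut p g \<omega> \<in> \<Gamma> p \<Omega>"
  unfolding \<Gamma>_eq by (auto intro: generate.incl)

lemma \<Gamma>_least:
  assumes "subgroup K tree_aut" "G \<subseteq> K"
    and "\<And>g \<omega>. g \<in> G \<Longrightarrow> \<omega> \<in> \<Omega> \<Longrightarrow> directed_aut p g \<omega> \<in> K"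
  shows "\<Gamma> p \<Omega> \<subseteq> K"
  unfolding \<Gamma>_eq using assms by (intro T.generate_subgroup_incl) auto

lemma hom_into_subgroup:
  assumes "\<phi> \<in> hom tree_aut tree_aut" "subgroup N tree_aut" "g \<in> G"
    and "\<And>a b. a \<in> G \<Longrightarrow> b \<in> G \<Longrightarrow>
      \<phi> (a \<otimes>\<^bsub>tree_aut\<^esub> b \<otimes>\<^bsub>tree_aut\<^esub> tree_inv a \<otimes>\<^bsub>tree_aut\<^esub> tree_inv b) \<in> N"
  shows "\<phi> g \<in> N"
  using perfect_hom_into_subgroup[OF tree_aut_group tree_aut_group assms(1,2) perfect G.subset]
    assms(3,4) by blast

lemma perfect_\<Gamma>: "perfect_subgroup tree_aut (\<Gamma> p \<Omega>)"
proof -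
  interpret \<Gamma>: subgroup "\<Gamma> p \<Omega>" tree_aut by (rule subgroup_\<Gamma>)
  let ?D = "derived tree_aut (\<Gamma> p \<Omega>)"
  have D: "subgroup ?D tree_aut" by (rule T.derived_is_subgroup) (rule \<Gamma>.subset)
  have "\<Gamma> p \<Omega> \<subseteq> ?D"
  proof (rule \<Gamma>_least[OF D])
    show "G \<subseteq> ?D"
      using T.mono_derived[of G "\<Gamma> p \<Omega>"] perfect G_in_\<Gamma>[of _ p \<Omega>]
      unfolding perfect_subgroup_def by blast
    show "directed_aut p g \<omega> \<in> ?D" if "g \<in> G" "\<omega> \<in> \<Omega>" for g \<omega>
    proof (rule hom_into_subgroup[OF directed_aut_hom D that(1)])
      interpret d: group_hom tree_aut tree_aut "\<lambda>\<alpha>. directed_aut p \<alpha> \<omega>"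
        by (simp add: group_hom_def group_hom_axioms_def tree_aut_group directed_aut_hom)
      fix a b assume ab: "a \<in> G" "b \<in> G"
      let ?d = "\<lambda>\<alpha>. directed_aut p \<alpha> \<omega>"
      have "?d (a \<otimes>\<^bsub>tree_aut\<^esub> b \<otimes>\<^bsub>tree_aut\<^esub> tree_inv a \<otimes>\<^bsub>tree_aut\<^esub> tree_inv b)
          = ?d a \<otimes>\<^bsub>tree_aut\<^esub> ?d b \<otimes>\<^bsub>tree_aut\<^esub> tree_inv (?d a) \<otimes>\<^bsub>tree_aut\<^esub> tree_inv (?d b)"
        using ab G.mem_carrier
        by (simp only: d.hom_mult d.hom_inv T.m_closed T.inv_closed)
      also have "\<dots> \<in> ?D"
        unfolding derived_def using ab that(2) directed_in_\<Gamma>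
        by (intro generate.incl) blast
      finally show "?d (a \<otimes>\<^bsub>tree_aut\<^esub> b \<otimes>\<^bsub>tree_aut\<^esub> tree_inv a \<otimes>\<^bsub>tree_aut\<^esub> tree_inv b) \<in> ?D" .
    qed
  qed
  moreover have "?D \<subseteq> \<Gamma> p \<Omega>" by (rule T.derived_incl[OF subset_refl subgroup_\<Gamma>])
  ultimately show ?thesis by (simp add: perfect_subgroup_def)
qed

text \<open>
  Here property H enters. With \<open>h \<in> G\<close> fixing \<open>\<omega> 0\<close> and moving \<open>p\<close>, the directed automorphism \<open>d\<close> of
  \<open>g\<close> lives below \<open>p\<close> and \<open>\<omega> 0\<close>, while the conjugate \<open>d'\<close> by \<open>h\<close> of another one lives below
  \<open>level_perm h p\<close> and \<open>\<omega> 0\<close>. Their commutator is therefore concentrated below \<open>\<omega> 0\<close>.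
\<close>

lemma place_commutator_in_\<Gamma>:
  assumes \<omega>: "\<omega> \<in> \<Omega>" "\<omega> 0 \<noteq> p" and g: "g \<in> G" and f: "f \<in> G"
  shows "place (\<omega> 0) (g \<circ> f \<circ> tree_inv g \<circ> tree_inv f) \<in> \<Gamma> p \<Omega>"
proof -
  let ?inv = "\<lambda>\<alpha>. tree_inv \<alpha>"
  interpret \<Gamma>: subgroup "\<Gamma> p \<Omega>" tree_aut by (rule subgroup_\<Gamma>)
  obtain h where h: "h \<in> G" "level_perm h (\<omega> 0) = \<omega> 0" "level_perm h p \<noteq> p"
    using property_H \<omega>(2) unfolding property_H_def by blast
  define s where "s = state h"
  have s: "s x \<in> G" for x using state_in[OF h(1)] by (simp add: s_def)
  \<comment> \<open>Chosen so that conjugation by \<open>h\<close> turns it into \<open>f\<close> below \<open>\<omega> 0\<close>.\<close>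
  define g' where "g' = ?inv (s (\<omega> 0)) \<circ> f \<circ> s (\<omega> 0)"
  have g': "g' \<in> G" unfolding g'_def using s f G.m_closed G.m_inv_closed by (metis tree_aut_mult)
  define d where "d = directed_aut p g \<omega>"
  define e where "e = directed_aut p g' (seq_shift \<omega>)"
  define d' where "d' = wreath id (\<lambda>x. if x = \<omega> 0 then f
        else if x = level_perm h p then s p \<circ> e \<circ> ?inv (s p) else id)"
  have eT: "e \<in> carrier tree_aut" using g' by (simp add: e_def directed_aut_in_tree_aut)
  have hw: "wreath (level_perm h) s = h" using h(1) by (simp add: s_def wreath_level_perm_state)
  have d'T: "d' \<in> carrier tree_aut"
    unfolding d'_def
  proof (rule wreath_in_tree_aut)
    fix x
    show "(if x = \<omega> 0 then f else if x = level_perm h p then s p \<circ> e \<circ> ?inv (s p) else id) \<in> carrier tree_aut"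
      using f s[of p] eT T.one_closed G.mem_carrier by (auto intro!: tree_aut_comp_closed)
  qed simp
  have ne: "level_perm h p \<noteq> \<omega> 0" using h \<omega>(2) by (metis G.mem_carrier level_perm_eq_iff)
  have "d' \<circ> wreath (level_perm h) s = wreath (level_perm h) s \<circ> directed_aut p g' \<omega>"
    unfolding d'_def directed_aut_wreath[of p g' \<omega>] wreath_comp e_def[symmetric]
  proof (rule arg_cong2[of _ _ _ _ wreath])
    show "(\<lambda>x. (if level_perm h x = \<omega> 0 then f
              else if level_perm h x = level_perm h p then s p \<circ> e \<circ> ?inv (s p) else id) \<circ> s x) =
        (\<lambda>x. s (id x) \<circ> (if x = p then e else if x = \<omega> 0 then g' else id))" (is "?l = ?r")
    proof
      fix x
      consider "x = p" | "x = \<omega> 0" "x \<noteq> p" | "x \<noteq> p" "x \<noteq> \<omega> 0" by blast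
      then show "?l x = ?r x"
      proof cases
        case 1
        then show ?thesis using ne s[of p] G.mem_carrier by (auto simp: fun_eq_iff)
      next
        case 2
        then show ?thesis using h s[of "\<omega> 0"] G.mem_carrier by (auto simp: fun_eq_iff g'_def)
      next
        case 3
        then have "level_perm h x \<noteq> \<omega> 0" "level_perm h x \<noteq> level_perm h p"
          using h by (metis G.mem_carrier level_perm_eq_iff)+
        then show ?thesis using 3 by simp
      qed
    qed
  qed simp
  then have "d' \<circ> h = h \<circ> directed_aut p g' \<omega>" by (simp add: hw)
  moreover have "h \<circ> directed_aut p g' \<omega> \<in> \<Gamma> p \<Omega>"
    using \<Gamma>.m_closed[OF G_in_\<Gamma>[OF h(1)] directed_in_\<Gamma>[OF g' \<omega>(1)]] by simp
  ultimately have d': "d' \<in> \<Gamma> p \<Omega>"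
    using T.subgroup_cancel_right[OF subgroup_\<Gamma> d'T G_in_\<Gamma>[OF h(1)]] by simp
  have d: "d \<in> \<Gamma> p \<Omega>" using g \<omega>(1) by (simp add: d_def directed_in_\<Gamma>)
  let ?c = "g \<circ> f \<circ> ?inv g \<circ> ?inv f"
  have "place (\<omega> 0) ?c \<circ> (d' \<circ> d) = d \<circ> d'"
    unfolding place_def d'_def d_def directed_aut_wreath[of p g \<omega>] wreath_comp
    using g f G.mem_carrier \<omega>(2) h(3) ne by (intro arg_cong2[of _ _ _ _ wreath]) (auto simp: fun_eq_iff)
  moreover have "d' \<circ> d \<in> \<Gamma> p \<Omega>" "d \<circ> d' \<in> \<Gamma> p \<Omega>"
    using \<Gamma>.m_closed[OF d d'] \<Gamma>.m_closed[OF d' d] by simp_all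
  moreover have "?c \<in> carrier tree_aut"
    using g f G.mem_carrier by (auto intro!: tree_aut_comp_closed)
  ultimately show ?thesis
    using T.subgroup_cancel_right[OF subgroup_\<Gamma>, of "place (\<omega> 0) ?c" "d' \<circ> d"] place_hom
    by (metis hom_in_carrier tree_aut_mult)
qed

lemma place_G_in_\<Gamma>:
  assumes "\<omega> \<in> \<Omega>" "\<omega> 0 \<noteq> p" "g \<in> G"
  shows "place x g \<in> \<Gamma> p \<Omega>"
proof -
  have *: "place (\<omega> 0) f \<in> \<Gamma> p \<Omega>" if "f \<in> G" for f
    using place_commutator_in_\<Gamma>[OF assms(1,2)]
    by (intro hom_into_subgroup[OF place_hom subgroup_\<Gamma> that]) simp
  obtain k where k: "k \<in> G" "level_perm k (\<omega> 0) = x" using transitive by blast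
  show ?thesis
    using place_transport[OF subgroup_\<Gamma> G_in_\<Gamma>[OF k(1)] subgroup state_in[OF k(1)] * assms(3)] k(2)
    by simp
qed

text \<open>
  A directed automorphism is the product of its pieces below \<open>p\<close> and below \<open>\<omega> 0\<close>. The latter is
  a copy of an element of \<open>G\<close>, so the former, a copy of a directed automorphism along the
  shifted sequence, lies in the group as well. The elements of \<open>G\<close> carry copies from \<open>p\<close> to any
  other letter.
\<close>

lemma place_\<Gamma>_in_\<Gamma>:
  assumes \<Omega>: "\<Omega> \<subseteq> seqs p" "\<Omega> \<noteq> {}" and \<beta>: "\<beta> \<in> \<Gamma> p (seq_shift ` \<Omega>)"
  shows "place x \<beta> \<in> \<Gamma> p \<Omega>"
proof -
  interpret \<Gamma>: subgroup "\<Gamma> p \<Omega>" tree_aut by (rule subgroup_\<Gamma>)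
  have nop: "\<omega> 0 \<noteq> p" if "\<omega> \<in> \<Omega>" for \<omega> using \<Omega>(1) that by (auto simp: seqs_def)
  obtain \<omega>0 where \<omega>0: "\<omega>0 \<in> \<Omega>" using \<Omega>(2) by blast
  have "\<Gamma> p (seq_shift ` \<Omega>) \<subseteq> {\<beta> \<in> carrier tree_aut. place p \<beta> \<in> \<Gamma> p \<Omega>}"
  proof (rule \<Gamma>_least)
    show "subgroup {\<beta> \<in> carrier tree_aut. place p \<beta> \<in> \<Gamma> p \<Omega>} tree_aut"
      by (rule subgroup_hom_vimage[OF tree_aut_group tree_aut_group place_hom subgroup_\<Gamma>])
    show "G \<subseteq> {\<beta> \<in> carrier tree_aut. place p \<beta> \<in> \<Gamma> p \<Omega>}"
      using place_G_in_\<Gamma>[OF \<omega>0 nop[OF \<omega>0]] by auto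
    fix g \<omega>' assume g: "g \<in> G" and "\<omega>' \<in> seq_shift ` \<Omega>"
    then obtain \<omega> where \<omega>: "\<omega> \<in> \<Omega>" "\<omega>' = seq_shift \<omega>" by blast
    let ?e = "directed_aut p g \<omega>'"
    have eT: "?e \<in> carrier tree_aut" using g by (simp add: directed_aut_in_tree_aut)
    have "place p ?e \<circ> place (\<omega> 0) g = directed_aut p g \<omega>"
      unfolding place_def wreath_comp directed_aut_wreath[of p g \<omega>] \<omega>(2)
      using nop[OF \<omega>(1)] by (intro arg_cong2[of _ _ _ _ wreath]) auto
    then have "place p ?e \<in> \<Gamma> p \<Omega>"
      using T.subgroup_cancel_right[OF subgroup_\<Gamma>[of p \<Omega>] hom_in_carrier[OF place_hom[of p] eT]
          place_G_in_\<Gamma>[OF \<omega>(1) nop[OF \<omega>(1)] g, of "\<omega> 0"]]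
        directed_in_\<Gamma>[OF g \<omega>(1), of p] by simp
    then show "?e \<in> {\<beta> \<in> carrier tree_aut. place p \<beta> \<in> \<Gamma> p \<Omega>}" using eT by simp
  qed
  then have *: "place p \<beta> \<in> \<Gamma> p \<Omega>" if "\<beta> \<in> \<Gamma> p (seq_shift ` \<Omega>)" for \<beta> using that by auto
  obtain k where k: "k \<in> G" "level_perm k p = x" using transitive by blast
  show ?thesis
    using place_transport[OF subgroup_\<Gamma> G_in_\<Gamma>[OF k(1)] subgroup_\<Gamma> G_in_\<Gamma>[OF state_in[OF k(1)]] * \<beta>] k(2)
    by simp
qed

text \<open>
  The group is the full permutational wreath product of the group of the shifted sequences
  with the permutations of letters coming from \<open>G\<close>. One inclusion holds on generators by
  self-similarity. For the other one, dividing \<open>\<alpha>\<close> by an element \<open>g \<in> G\<close> with the same action on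
  letters leaves an automorphism that is a product of copies below letters.
\<close>

theorem \<Gamma>_wreath_recursion:
  assumes \<Omega>: "\<Omega> \<subseteq> seqs p" "\<Omega> \<noteq> {}"
  shows "\<Gamma> p \<Omega> = {\<alpha> \<in> carrier tree_aut. level_perm \<alpha> \<in> level_perm ` G \<and>
                                  (\<forall>x. state \<alpha> x \<in> \<Gamma> p (seq_shift ` \<Omega>))}"
    (is "_ = ?W")
proof
  let ?\<Gamma>' = "\<Gamma> p (seq_shift ` \<Omega>)"
  interpret \<Gamma>: subgroup "\<Gamma> p \<Omega>" tree_aut by (rule subgroup_\<Gamma>)
  interpret \<Gamma>': subgroup ?\<Gamma>' tree_aut by (rule subgroup_\<Gamma>)
  show "\<Gamma> p \<Omega> \<subseteq> ?W"
  proof (rule \<Gamma>_least)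
    show "subgroup ?W tree_aut" by (rule subgroup_wreath_product[OF subgroup subgroup_\<Gamma>])
    show "G \<subseteq> ?W" using G_in_\<Gamma>[OF state_in] by auto
    fix g \<omega> assume g: "g \<in> G" and \<omega>: "\<omega> \<in> \<Omega>"
    have "id \<in> level_perm ` G" using G.one_closed by (auto intro!: image_eqI[of _ _ id])
    moreover have "state (directed_aut p g \<omega>) x \<in> ?\<Gamma>'" for x
      using g \<omega> G_in_\<Gamma> directed_in_\<Gamma> \<Gamma>'.one_closed
      unfolding directed_aut_wreath[of p g \<omega>] by simp
    moreover have "level_perm (directed_aut p g \<omega>) = id"
      unfolding directed_aut_wreath[of p g \<omega>] by simp
    ultimately show "directed_aut p g \<omega> \<in> ?W" using g by (simp add: directed_aut_in_tree_aut)
  qed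
  show "?W \<subseteq> \<Gamma> p \<Omega>"
  proof
    fix \<alpha> assume \<alpha>: "\<alpha> \<in> ?W"
    then obtain g where g: "g \<in> G" "level_perm \<alpha> = level_perm g" by auto
    define x where "x y = inv_into UNIV (level_perm g) y" for y
    have x: "x (level_perm g z) = z" for z
      unfolding x_def using level_perm_bij[of g] g(1) by (simp add: bij_is_inj)
    \<comment> \<open>The state of \<open>\<alpha> g\<inverse>\<close> at \<open>y\<close>, where \<open>x y\<close> is the letter that \<open>g\<close> sends to \<open>y\<close>.\<close>
    define \<gamma> where "\<gamma> y = state \<alpha> (x y) \<circ> tree_inv (state g (x y))" for y
    have "\<gamma> y \<in> ?\<Gamma>'" for y
      using \<Gamma>'.m_closed[OF _ \<Gamma>'.m_inv_closed[OF G_in_\<Gamma>[OF state_in[OF g(1)]]]] \<alpha>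
      by (simp add: \<gamma>_def)
    then have "wreath id \<gamma> \<in> \<Gamma> p \<Omega>"
      using place_\<Gamma>_in_\<Gamma>[OF \<Omega>] by (intro wreath_id_in_subgroup subgroup_\<Gamma>) auto
    then have "wreath id \<gamma> \<circ> g \<in> \<Gamma> p \<Omega>" using \<Gamma>.m_closed[OF _ G_in_\<Gamma>[OF g(1)]] by simp
    moreover have "wreath id \<gamma> \<circ> wreath (level_perm g) (state g) = wreath (level_perm \<alpha>) (state \<alpha>)"
      unfolding wreath_comp g(2)
      using state_in_tree_aut[of g] g(1)
      by (intro arg_cong2[of _ _ _ _ wreath]) (auto simp: \<gamma>_def x fun_eq_iff)
    ultimately show "\<alpha> \<in> \<Gamma> p \<Omega>" using \<alpha> g(1) by (simp add: wreath_level_perm_state)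
  qed
qed

lemma seq_shift_seqs:
  assumes "\<Omega> \<subseteq> seqs p" "\<Omega> \<noteq> {}"
  shows "seq_shift ` \<Omega> \<subseteq> seqs p" "seq_shift ` \<Omega> \<noteq> {}"
  using assms by (auto simp: seqs_def seq_shift_def)

lemma place_at_in_\<Gamma>:
  assumes "\<Omega> \<subseteq> seqs p" "\<Omega> \<noteq> {}" "\<beta> \<in> \<Gamma> p (((`) seq_shift ^^ length v) \<Omega>)"
  shows "place_at v \<beta> \<in> \<Gamma> p \<Omega>"
  using assms
proof (induction v arbitrary: \<Omega>)
  case (Cons x v)
  have "place_at v \<beta> \<in> \<Gamma> p (seq_shift ` \<Omega>)"
    using Cons.IH[OF seq_shift_seqs[OF Cons.prems(1,2)]] Cons.prems(3) by (simp add: funpow_swap1)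
  then show ?case using place_\<Gamma>_in_\<Gamma>[OF Cons.prems(1,2)] by simp
qed simp

lemma level_transitive:
  fixes v w :: "'a list"
  assumes "\<Omega> \<subseteq> seqs p" "\<Omega> \<noteq> {}" "length v = length w"
  shows "\<exists>\<gamma>\<in>\<Gamma> p \<Omega>. \<gamma> v = w"
  using assms(3,1,2)
proof (induction v w arbitrary: \<Omega> rule: list_induct2)
  case Nil
  show ?case
    using subgroup.one_closed[OF subgroup_\<Gamma>] by (intro bexI[of _ id]) auto
next
  case (Cons x v y w)
  obtain \<delta> where \<delta>: "\<delta> \<in> \<Gamma> p (seq_shift ` \<Omega>)" "\<delta> v = w"
    using Cons.IH[OF seq_shift_seqs[OF Cons.prems]] by blast
  obtain g where g: "g \<in> G" "level_perm g x = y" using transitive by blast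
  have "wreath (level_perm g) (\<lambda>_. \<delta>) \<in> \<Gamma> p \<Omega>"
    unfolding \<Gamma>_wreath_recursion[OF Cons.prems]
    using g \<delta> level_perm_bij[of g] subgroup.mem_carrier[OF subgroup_\<Gamma> \<delta>(1)]
    by (auto intro: wreath_in_tree_aut)
  then show ?case using \<delta> g by (intro bexI) auto
qed

section \<open>The congruence subgroup property\<close>

text \<open>
  The orbit of a vertex of level \<open>n\<close> is the whole level, which has more than \<open>n\<close> elements: the
  letters \<open>p\<close> and \<open>\<omega> 0\<close> are different.
\<close>

lemma infinite_\<Gamma>:
  assumes "\<Omega> \<subseteq> seqs p" "\<Omega> \<noteq> {}"
  shows "infinite (\<Gamma> p \<Omega>)"
proof
  assume fin: "finite (\<Gamma> p \<Omega>)"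
  define n where "n = card (\<Gamma> p \<Omega>)"
  obtain \<omega> where "\<omega> \<in> seqs p" using assms by blast
  then have "card {p, \<omega> 0} = 2" by (auto simp: seqs_def card_2_iff)
  then have two: "2 \<le> CARD('a)" using card_mono[of UNIV "{p, \<omega> 0}"] by simp
  have "{w. length w = n} \<subseteq> (\<lambda>\<gamma>. \<gamma> (replicate n p)) ` \<Gamma> p \<Omega>"
  proof
    fix w :: "'a list" assume "w \<in> {w. length w = n}"
    then obtain \<gamma> where "\<gamma> \<in> \<Gamma> p \<Omega>" "\<gamma> (replicate n p) = w"
      using level_transitive[OF assms, of "replicate n p" w] by auto
    then show "w \<in> (\<lambda>\<gamma>. \<gamma> (replicate n p)) ` \<Gamma> p \<Omega>" by blast
  qed
  then have "card {w :: 'a list. length w = n} \<le> n"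
    unfolding n_def by (rule surj_card_le[OF fin])
  moreover have "card {w :: 'a list. length w = n} = CARD('a) ^ n"
    using card_lists_length_eq[of "UNIV :: 'a set" n] by simp
  moreover have "n < CARD('a) ^ n"
    using two less_exp[of n] power_mono[of 2 "CARD('a)" n] by linarith
  ultimately show False by simp
qed

text \<open>
  The stabiliser of level \<open>n\<close> is generated by the copies below the vertices of level \<open>n\<close>. By
  induction on the level, applied to the states: for a fixed first letter \<open>x\<close>, the
  automorphisms whose copy below \<open>x\<close> lies in \<open>K\<close> form a subgroup to which the induction
  hypothesis applies.
\<close>

lemma level_stab_in_subgroup:
  assumes "\<Omega> \<subseteq> seqs p" "\<Omega> \<noteq> {}" "subgroup K tree_aut"
    and "\<And>v \<beta>. length v = n \<Longrightarrow> \<beta> \<in> \<Gamma> p (((`) seq_shift ^^ n) \<Omega>) \<Longrightarrow> place_at v \<beta> \<in> K"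
    and "\<alpha> \<in> \<Gamma> p \<Omega>" "\<And>w. length w = n \<Longrightarrow> \<alpha> w = w"
  shows "\<alpha> \<in> K"
  using assms
proof (induction n arbitrary: \<Omega> K \<alpha>)
  case 0
  then show ?case using "0.prems"(4)[of "[]"] by simp
next
  case (Suc n)
  note \<Omega>' = seq_shift_seqs[OF Suc.prems(1,2)]
  have \<alpha>: "\<alpha> \<in> carrier tree_aut" "\<And>x. state \<alpha> x \<in> \<Gamma> p (seq_shift ` \<Omega>)"
    using Suc.prems(5) unfolding \<Gamma>_wreath_recursion[OF Suc.prems(1,2)] by auto
  have fix_state: "level_perm \<alpha> x = x \<and> state \<alpha> x w = w" if "length w = n" for x w
    using Suc.prems(6)[of "x # w"] tree_aut_Cons[OF \<alpha>(1)] that by simp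
  have "place x (state \<alpha> x) \<in> K" for x
  proof -
    have "state \<alpha> x \<in> {\<beta> \<in> carrier tree_aut. place x \<beta> \<in> K}"
    proof (rule Suc.IH[OF \<Omega>' _ _ \<alpha>(2)])
      show "subgroup {\<beta> \<in> carrier tree_aut. place x \<beta> \<in> K} tree_aut"
        by (rule subgroup_hom_vimage[OF tree_aut_group tree_aut_group place_hom Suc.prems(3)])
      fix v :: "'a list" and \<beta> assume v: "length v = n" and \<beta>: "\<beta> \<in> \<Gamma> p (((`) seq_shift ^^ n) (seq_shift ` \<Omega>))"
      then have "place_at (x # v) \<beta> \<in> K"
        by (intro Suc.prems(4)) (auto simp: funpow_swap1)
      moreover have "place_at v \<beta> \<in> carrier tree_aut"
        using subgroup.mem_carrier[OF subgroup_\<Gamma> \<beta>] by (rule hom_in_carrier[OF place_at_hom])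
      ultimately show "place_at v \<beta> \<in> {\<beta> \<in> carrier tree_aut. place x \<beta> \<in> K}" by simp
    qed (use fix_state in auto)
    then show ?thesis by simp
  qed
  then have "wreath id (state \<alpha>) \<in> K" by (rule wreath_id_in_subgroup[OF Suc.prems(3)])
  moreover have "level_perm \<alpha> = id" using fix_state[OF length_replicate] by auto
  ultimately show ?case using wreath_level_perm_state[OF \<alpha>(1)] by simp
qed

text \<open>
  For \<open>A\<close> and \<open>B\<close> supported below \<open>v\<close>, the conjugate \<open>D = \<alpha> A\<inverse> \<alpha>\<inverse>\<close> is supported below \<open>\<alpha> v \<noteq> v\<close> and so
  commutes with \<open>B\<close>. Hence the commutator of \<open>A D \<in> N\<close> with \<open>B\<close> is that of \<open>A\<close> with \<open>B\<close>, and \<open>N\<close>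
  contains all commutators of the perfect group of copies below \<open>v\<close>.
\<close>

lemma normal_contains_place_at:
  assumes \<Omega>: "\<Omega> \<subseteq> seqs p" "\<Omega> \<noteq> {}"
    and N: "subgroup N tree_aut" "\<And>\<gamma> \<nu>. \<gamma> \<in> \<Gamma> p \<Omega> \<Longrightarrow> \<nu> \<in> N \<Longrightarrow> \<gamma> \<circ> \<nu> \<circ> tree_inv \<gamma> \<in> N"
    and \<alpha>: "\<alpha> \<in> N" "\<alpha> v \<noteq> v"
    and \<beta>: "\<beta> \<in> \<Gamma> p (((`) seq_shift ^^ length v) \<Omega>)"
  shows "place_at v \<beta> \<in> N"
proof -
  let ?\<Gamma>n = "\<Gamma> p (((`) seq_shift ^^ length v) \<Omega>)"
  let ?inv = "\<lambda>\<alpha>. tree_inv \<alpha>"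
  interpret N: subgroup N tree_aut by (rule N(1))
  interpret \<Gamma>n: subgroup ?\<Gamma>n tree_aut by (rule subgroup_\<Gamma>)
  interpret pl: group_hom tree_aut tree_aut "place_at v"
    by (simp add: group_hom_def group_hom_axioms_def tree_aut_group place_at_hom)
  have \<alpha>T: "\<alpha> \<in> carrier tree_aut" using \<alpha>(1) by simp
  show ?thesis
  proof (rule perfect_hom_into_subgroup[OF tree_aut_group tree_aut_group place_at_hom N(1)
        perfect_\<Gamma> \<Gamma>n.subset _ \<beta>])
    fix a b assume ab: "a \<in> ?\<Gamma>n" "b \<in> ?\<Gamma>n"
    define A where "A = place_at v a"
    define B where "B = place_at v b"
    have AT: "A \<in> carrier tree_aut" and BT: "B \<in> carrier tree_aut"
      using ab by (simp_all add: A_def B_def)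
    have A\<Gamma>: "A \<in> \<Gamma> p \<Omega>" and B\<Gamma>: "B \<in> \<Gamma> p \<Omega>"
      using place_at_in_\<Gamma>[OF \<Omega>] ab by (simp_all add: A_def B_def)
    define D where "D = \<alpha> \<circ> ?inv A \<circ> ?inv \<alpha>"
    have DT: "D \<in> carrier tree_aut"
      using \<alpha>T AT T.m_closed[OF T.m_closed[OF \<alpha>T T.inv_closed[OF AT]] T.inv_closed[OF \<alpha>T]]
      by (simp add: D_def)
    have "A \<circ> D = (A \<circ> \<alpha> \<circ> ?inv A) \<circ> ?inv \<alpha>" by (simp add: D_def comp_assoc)
    then have ADN: "A \<circ> D \<in> N"
      using N.m_closed[OF N(2)[OF A\<Gamma> \<alpha>(1)] N.m_inv_closed[OF \<alpha>(1)]] by simp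
    have "D \<circ> B = B \<circ> D"
    proof (rule disjoint_supports_commute[of D "\<lambda>u. take (length v) u = \<alpha> v"])
      fix u assume "D u \<noteq> u"
      then have "?inv A (?inv \<alpha> u) \<noteq> ?inv \<alpha> u"
        using \<alpha>T by (auto simp: D_def)
      then have "A (?inv \<alpha> u) \<noteq> ?inv \<alpha> u" using AT by (metis tree_aut_inv_apply(1))
      then have "take (length v) (?inv \<alpha> u) = v" by (auto simp: A_def intro: place_at_support)
      then have "\<alpha> (take (length v) (?inv \<alpha> u)) = \<alpha> v" by simp
      then show "take (length v) u = \<alpha> v" using \<alpha>T by (simp flip: tree_aut_take)
    next
      fix u assume "B u \<noteq> u"
      then have "take (length v) u = v" by (auto simp: B_def intro: place_at_support)
      then show "take (length v) u \<noteq> \<alpha> v" using \<alpha>(2) by simp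
    qed (use DT BT in \<open>auto intro: bij_is_inj tree_aut_bij\<close>)
    then have "(A \<otimes>\<^bsub>tree_aut\<^esub> D) \<otimes>\<^bsub>tree_aut\<^esub> B \<otimes>\<^bsub>tree_aut\<^esub> ?inv (A \<otimes>\<^bsub>tree_aut\<^esub> D) \<otimes>\<^bsub>tree_aut\<^esub> ?inv B
             = A \<otimes>\<^bsub>tree_aut\<^esub> B \<otimes>\<^bsub>tree_aut\<^esub> ?inv A \<otimes>\<^bsub>tree_aut\<^esub> ?inv B"
      by (intro T.commutator_of_commutator AT BT DT) simp
    moreover have "(A \<circ> D) \<circ> (B \<circ> ?inv (A \<circ> D) \<circ> ?inv B) \<in> N"
      using N.m_closed[OF ADN N(2)[OF B\<Gamma> N.m_inv_closed[OF ADN]]] by simp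
    ultimately have "A \<otimes>\<^bsub>tree_aut\<^esub> B \<otimes>\<^bsub>tree_aut\<^esub> ?inv A \<otimes>\<^bsub>tree_aut\<^esub> ?inv B \<in> N"
      by (simp add: comp_assoc)
    also have "A \<otimes>\<^bsub>tree_aut\<^esub> B \<otimes>\<^bsub>tree_aut\<^esub> ?inv A \<otimes>\<^bsub>tree_aut\<^esub> ?inv B
        = place_at v (a \<otimes>\<^bsub>tree_aut\<^esub> b \<otimes>\<^bsub>tree_aut\<^esub> ?inv a \<otimes>\<^bsub>tree_aut\<^esub> ?inv b)"
      unfolding A_def B_def using ab \<Gamma>n.mem_carrier
      by (simp only: pl.hom_mult pl.hom_inv T.m_closed T.inv_closed)
    finally show "place_at v (a \<otimes>\<^bsub>tree_aut\<^esub> b \<otimes>\<^bsub>tree_aut\<^esub> ?inv a \<otimes>\<^bsub>tree_aut\<^esub> ?inv b) \<in> N" .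
  qed
qed

text \<open>
  Let \<open>\<alpha> \<in> N\<close> move the vertex \<open>v\<close>. Any other vertex of the same level is moved by a conjugate
  of \<open>\<alpha>\<close>, by transitivity on the level. So \<open>N\<close> contains the copies below all vertices of the
  level of \<open>v\<close>, and these generate the level stabiliser.
\<close>

theorem nontrivial_normal_contains_level_stab:
  assumes \<Omega>: "\<Omega> \<subseteq> seqs p" "\<Omega> \<noteq> {}"
    and N: "N \<lhd> Gamma_group p G \<Omega>" "N \<noteq> {id}"
  shows "\<exists>n. \<Gamma> p \<Omega> \<inter> level_stab n \<subseteq> N"
proof -
  interpret \<Gamma>: subgroup "\<Gamma> p \<Omega>" tree_aut by (rule subgroup_\<Gamma>)
  interpret N: normal N "Gamma_group p G \<Omega>" by (rule N(1))
  have NT: "subgroup N tree_aut"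
    using T.subgroup_of_subgroup_generated N.subgroup_axioms
    unfolding Gamma_group_def using T.subgroup_subgroup_generated_iff by blast
  have conj: "\<gamma> \<circ> \<nu> \<circ> tree_inv \<gamma> \<in> N" if "\<gamma> \<in> \<Gamma> p \<Omega>" "\<nu> \<in> N" for \<gamma> \<nu>
    using N.inv_op_closed2[OF that] that(1) by (simp add: Gamma_group_def)
  have "id \<in> N" using subgroup.one_closed[OF NT] by simp
  then obtain \<alpha> v where \<alpha>: "\<alpha> \<in> N" "\<alpha> v \<noteq> v"
    using N(2) by (metis eq_id_iff insertI1 subsetI subset_singletonD empty_iff singletonI)
  have "\<beta> \<in> N" if \<beta>: "\<beta> \<in> \<Gamma> p \<Omega>" "\<And>w. length w = length v \<Longrightarrow> \<beta> w = w" for \<beta>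
  proof (rule level_stab_in_subgroup[OF \<Omega> NT _ \<beta>])
    fix w :: "'a list" and \<beta> assume w: "length w = length v" and \<beta>: "\<beta> \<in> \<Gamma> p (((`) seq_shift ^^ length v) \<Omega>)"
    obtain \<gamma> where \<gamma>: "\<gamma> \<in> \<Gamma> p \<Omega>" "\<gamma> v = w" using level_transitive[OF \<Omega> w[symmetric]] by blast
    then have \<gamma>T: "\<gamma> \<in> carrier tree_aut" by simp
    have "(\<gamma> \<circ> \<alpha> \<circ> tree_inv \<gamma>) w \<noteq> w"
      using \<alpha>(2) \<gamma>(2)[symmetric] \<gamma>T tree_aut_bij[OF \<gamma>T] by (simp add: bij_is_inj inj_eq)
    then show "place_at w \<beta> \<in> N"
      using normal_contains_place_at[OF \<Omega> NT conj conj[OF \<gamma>(1) \<alpha>(1)]] \<beta> w by simp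
  qed
  then have "\<Gamma> p \<Omega> \<inter> level_stab (length v) \<subseteq> N" by (auto simp: level_stab_def)
  then show ?thesis by blast
qed

theorem congruence_subgroup_property:
  assumes \<Omega>: "\<Omega> \<subseteq> seqs p" "\<Omega> \<noteq> {}" and N: "N \<in> fin_index_normal (Gamma_group p G \<Omega>)"
  shows "\<exists>n. \<Gamma> p \<Omega> \<inter> level_stab n \<subseteq> N"
proof -
  have "N \<noteq> {id}"
  proof
    assume "N = {id}"
    then have "(\<lambda>x. N #>\<^bsub>Gamma_group p G \<Omega>\<^esub> x) = (\<lambda>x. {x})"
      by (simp add: r_coset_def Gamma_group_def)
    moreover have "finite ((\<lambda>x. N #>\<^bsub>Gamma_group p G \<Omega>\<^esub> x) ` \<Gamma> p \<Omega>)"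
      using N by (simp add: fin_index_normal_def carrier_FactGroup)
    ultimately have "finite (\<Gamma> p \<Omega>)" by (simp add: finite_image_iff)
    then show False using infinite_\<Gamma>[OF \<Omega>] by simp
  qed
  then show ?thesis
    by (rule nontrivial_normal_contains_level_stab[OF \<Omega> fin_index_normalD(1)[OF N]])
qed

end

section \<open>Comparing two groups\<close>

text \<open>
  By the wreath recursion, the action on level \<open>n + 1\<close> can be prescribed through the action on
  letters and the actions of the states on level \<open>n\<close>, independently of each other.
\<close>

lemma level_approximation:
  fixes G H :: "('a :: finite list \<Rightarrow> 'a list) set"
  assumes "perfect_self_similar G" "perfect_self_similar H" "level_perm ` G = level_perm ` H"
    and "\<Omega> \<subseteq> seqs p" "\<Omega> \<noteq> {}" "\<Omega>' \<subseteq> seqs p" "\<Omega>' \<noteq> {}"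
    and "\<alpha> \<in> carrier (Gamma_group p H \<Omega>')"
  shows "\<exists>\<gamma>\<in>carrier (Gamma_group p G \<Omega>). \<forall>w. length w = n \<longrightarrow> \<gamma> w = \<alpha> w"
  using assms(4-)
proof (induction n arbitrary: \<Omega> \<Omega>' \<alpha>)
  interpret G: perfect_self_similar G by fact
  interpret H: perfect_self_similar H by fact
  {
    case 0
    have "id \<in> G.\<Gamma> p \<Omega>" using subgroup.one_closed[OF G.subgroup_\<Gamma>] by simp
    moreover have "\<alpha> [] = []"
      using tree_aut_length[OF subgroup.mem_carrier[OF H.subgroup_\<Gamma> "0.prems"(5)], of "[]"] by simp
    ultimately show ?case by (intro bexI[of _ id]) auto
  next
    case (Suc n)
    let ?\<Omega> = "seq_shift ` \<Omega>" and ?\<Omega>' = "seq_shift ` \<Omega>'"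
    have \<alpha>: "\<alpha> \<in> carrier tree_aut" "level_perm \<alpha> \<in> level_perm ` G" "\<And>x. state \<alpha> x \<in> H.\<Gamma> p ?\<Omega>'"
      using Suc.prems(5) unfolding H.\<Gamma>_wreath_recursion[OF Suc.prems(3,4)] assms(3) by auto
    have "\<exists>\<gamma>\<in>G.\<Gamma> p ?\<Omega>. \<forall>w. length w = n \<longrightarrow> \<gamma> w = state \<alpha> x w" for x
      by (rule Suc.IH[OF G.seq_shift_seqs[OF Suc.prems(1,2)] G.seq_shift_seqs[OF Suc.prems(3,4)] \<alpha>(3)])
    then obtain \<gamma> where \<gamma>: "\<And>x. \<gamma> x \<in> G.\<Gamma> p ?\<Omega>" "\<And>x w. length w = n \<Longrightarrow> \<gamma> x w = state \<alpha> x w"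
      by metis
    have "wreath (level_perm \<alpha>) \<gamma> \<in> G.\<Gamma> p \<Omega>"
      unfolding G.\<Gamma>_wreath_recursion[OF Suc.prems(1,2)]
      using \<alpha>(1,2) \<gamma>(1) level_perm_bij[OF \<alpha>(1)] subgroup.mem_carrier[OF G.subgroup_\<Gamma> \<gamma>(1)]
      by (auto intro: wreath_in_tree_aut)
    moreover have "wreath (level_perm \<alpha>) \<gamma> w = \<alpha> w" if "length w = Suc n" for w
      using that \<gamma>(2) tree_aut_Cons[OF \<alpha>(1)] by (cases w) auto
    ultimately show ?case by blast
  }
qed

text \<open>
  Finite index normal subgroups contain level stabilisers, so the two hypotheses of
  \<open>profinite_map_inclusion_iso\<close> need only be checked for these. Density is then the coincidence of
  the actions on each level, and cofinality is clear, since the trace of a level stabiliser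
  is a level stabiliser.
\<close>

theorem Gamma_inclusion_profinite_isomorphism:
  fixes G H :: "('a :: finite list \<Rightarrow> 'a list) set"
  assumes G: "perfect_self_similar G" and H: "perfect_self_similar H"
    and perms: "level_perm ` G = level_perm ` H" and "G \<subseteq> H"
    and \<Omega>: "\<Omega> \<subseteq> seqs p" "\<Omega> \<noteq> {}" and \<Omega>': "\<Omega>' \<subseteq> seqs p" and "\<Omega> \<subseteq> \<Omega>'"
  shows "subgroup (carrier (Gamma_group p G \<Omega>)) (Gamma_group p H \<Omega>') \<and>
         profinite_isomorphism (Gamma_group p G \<Omega>) (Gamma_group p H \<Omega>')
           (profinite_map (Gamma_group p G \<Omega>) (Gamma_group p H \<Omega>') (\<lambda>x. x))"
proof -
  interpret G: perfect_self_similar G by fact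
  interpret H: perfect_self_similar H by fact
  let ?A = "G.\<Gamma> p \<Omega>" and ?B = "H.\<Gamma> p \<Omega>'" and ?D = "Gamma_group p H \<Omega>'"
  have \<Omega>'': "\<Omega>' \<noteq> {}" using \<Omega>(2) \<open>\<Omega> \<subseteq> \<Omega>'\<close> by blast
  have D_eq: "?D = tree_aut\<lparr>carrier := ?B\<rparr>"
    by (simp add: Gamma_group_def subgroup_generated_def)
  have A_eq: "Gamma_group p G \<Omega> = ?D\<lparr>carrier := ?A\<rparr>"
    by (simp add: Gamma_group_def subgroup_generated_def)
  interpret A: subgroup ?A tree_aut by (rule G.subgroup_\<Gamma>)
  interpret B: subgroup ?B tree_aut by (rule H.subgroup_\<Gamma>)
  interpret D: group ?D unfolding Gamma_group_def by (rule T.group_subgroup_generated)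
  have "?A \<subseteq> ?B"
  proof (rule G.\<Gamma>_least[OF H.subgroup_\<Gamma>])
    show "G \<subseteq> ?B" using \<open>G \<subseteq> H\<close> H.G_in_\<Gamma>[of _ p \<Omega>'] by blast
    show "directed_aut p g \<omega> \<in> ?B" if "g \<in> G" "\<omega> \<in> \<Omega>" for g \<omega>
      using that \<open>G \<subseteq> H\<close> \<open>\<Omega> \<subseteq> \<Omega>'\<close> by (intro H.directed_in_\<Gamma>) auto
  qed
  then have sub: "subgroup ?A ?D"
    using T.subgroup_incl[OF G.subgroup_\<Gamma> H.subgroup_\<Gamma>, of p \<Omega> p \<Omega>'] by (simp flip: D_eq)
  have "profinite_isomorphism (?D\<lparr>carrier := ?A\<rparr>) ?D (profinite_map (?D\<lparr>carrier := ?A\<rparr>) ?D (\<lambda>x. x))"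
  proof (rule D.profinite_map_inclusion_iso[OF sub])
    fix M \<alpha> assume M: "M \<in> fin_index_normal ?D" and \<alpha>: "\<alpha> \<in> ?B"
    obtain n where n: "?B \<inter> level_stab n \<subseteq> M"
      using H.congruence_subgroup_property[OF \<Omega>' \<Omega>'' M] by blast
    obtain \<gamma> where \<gamma>: "\<gamma> \<in> ?A" "\<And>w. length w = n \<Longrightarrow> \<gamma> w = \<alpha> w"
      using level_approximation[OF G H perms \<Omega> \<Omega>' \<Omega>'' \<alpha>, of n] by blast
    have \<gamma>B: "\<gamma> \<in> ?B" using \<gamma>(1) \<open>?A \<subseteq> ?B\<close> by blast
    have "\<gamma> \<circ> tree_inv \<alpha> \<in> level_stab n"
      using \<gamma>B \<alpha> \<gamma>(2) by (intro level_stab_quotient) auto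
    moreover have "\<gamma> \<circ> tree_inv \<alpha> \<in> ?B"
      using B.m_closed[OF \<gamma>B B.m_inv_closed[OF \<alpha>]] by simp
    ultimately have "\<gamma> \<circ> tree_inv \<alpha> \<in> M" using n by blast
    moreover have "\<gamma> = (\<gamma> \<circ> tree_inv \<alpha>) \<circ> \<alpha>" using \<alpha> by (simp add: comp_assoc)
    moreover have "M #>\<^bsub>?D\<^esub> \<alpha> = (\<Union>\<mu>\<in>M. {\<mu> \<circ> \<alpha>})"
      by (simp add: r_coset_def Gamma_group_def)
    ultimately have "\<gamma> \<in> M #>\<^bsub>?D\<^esub> \<alpha>" by auto
    then show "(M #>\<^bsub>?D\<^esub> \<alpha>) \<inter> ?A \<noteq> {}" using \<gamma>(1) by blast
  next
    fix N assume "N \<in> fin_index_normal (?D\<lparr>carrier := ?A\<rparr>)"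
    then have "N \<in> fin_index_normal (Gamma_group p G \<Omega>)" by (simp only: A_eq[symmetric])
    then obtain n where n: "?A \<inter> level_stab n \<subseteq> N"
      using G.congruence_subgroup_property[OF \<Omega>] by blast
    have "?B \<inter> level_stab n \<in> fin_index_normal ?D"
      using T.fin_index_normal_restrict[OF H.subgroup_\<Gamma> level_stab_fin_index_normal, of p \<Omega>' n]
      by (simp only: D_eq[symmetric])
    moreover have "?A \<inter> (?B \<inter> level_stab n) \<subseteq> N" using n by blast
    ultimately show "\<exists>M\<in>fin_index_normal ?D. ?A \<inter> M \<subseteq> N" by blast
  qed
  then show ?thesis using sub unfolding A_eq[symmetric] by simp
qed

text \<open>
  The subgroup generated by both groups serves as a common overgroup. Its elements have the
  same permutations of letters, because these form a group that contains those of the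
  generators.
\<close>

lemma perfect_self_similar_join:
  fixes G H :: "('a :: finite list \<Rightarrow> 'a list) set"
  assumes G: "perfect_self_similar G" and H: "perfect_self_similar H"
    and perms: "level_perm ` G = level_perm ` H"
  shows "perfect_self_similar (generate tree_aut (G \<union> H))"
    and "level_perm ` generate tree_aut (G \<union> H) = level_perm ` G"
proof -
  interpret G: perfect_self_similar G by fact
  interpret H: perfect_self_similar H by fact
  let ?K = "generate tree_aut (G \<union> H)"
  have GH: "G \<union> H \<subseteq> carrier tree_aut" using G.G.subset H.G.subset by blast
  have K: "subgroup ?K tree_aut" by (rule T.generate_is_subgroup[OF GH])
  have incl: "G \<union> H \<subseteq> ?K" by (auto intro: generate.incl)
  have "?K \<subseteq> {\<alpha> \<in> carrier tree_aut. level_perm \<alpha> \<in> level_perm ` G \<and> (\<forall>x. state \<alpha> x \<in> ?K)}"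
  proof (rule T.generate_subgroup_incl)
    show "subgroup {\<alpha> \<in> carrier tree_aut. level_perm \<alpha> \<in> level_perm ` G \<and> (\<forall>x. state \<alpha> x \<in> ?K)} tree_aut"
      by (rule subgroup_wreath_product[OF G.subgroup K])
    show "G \<union> H \<subseteq> {\<alpha> \<in> carrier tree_aut. level_perm \<alpha> \<in> level_perm ` G \<and> (\<forall>x. state \<alpha> x \<in> ?K)}"
    proof
      fix g assume g: "g \<in> G \<union> H"
      have "level_perm g \<in> level_perm ` G"
        using g perms by (metis UnE imageI)
      moreover have "state g x \<in> ?K" for x
        using g G.state_in[of g x] H.state_in[of g x] incl by blast
      ultimately show "g \<in> {\<alpha> \<in> carrier tree_aut. level_perm \<alpha> \<in> level_perm ` G \<and> (\<forall>x. state \<alpha> x \<in> ?K)}"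
        using g GH by blast
    qed
  qed
  then have states: "self_similar ?K" and "level_perm ` ?K \<subseteq> level_perm ` G"
    by (auto simp: self_similar_def)
  then show "level_perm ` ?K = level_perm ` G" using incl by blast
  have D: "subgroup (derived tree_aut ?K) tree_aut"
    by (rule T.derived_is_subgroup[OF subgroup.subset[OF K]])
  have "G \<union> H \<subseteq> derived tree_aut ?K"
    using T.mono_derived[of G ?K] T.mono_derived[of H ?K] G.perfect H.perfect incl
    unfolding perfect_subgroup_def by blast
  then have "?K \<subseteq> derived tree_aut ?K" by (rule T.generate_subgroup_incl[OF _ D])
  moreover have "derived tree_aut ?K \<subseteq> ?K" by (rule T.derived_incl[OF subset_refl K])
  ultimately have "perfect_subgroup tree_aut ?K" by (simp add: perfect_subgroup_def)
  moreover have "property_H ?K"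
    unfolding property_H_def
  proof (intro conjI allI impI)
    show "\<exists>g\<in>?K. level_perm g x = y" for x y
      using G.transitive[of x y] incl by blast
    show "\<exists>g\<in>?K. level_perm g x = x \<and> level_perm g y \<noteq> y" if "x \<noteq> y" for x y
      using G.property_H that incl unfolding property_H_def by (meson UnI1 subsetD)
  qed
  ultimately show "perfect_self_similar ?K"
    using K states by (simp add: perfect_self_similar_def)
qed

theorem corollary4p7:
  fixes p :: "'a :: finite"
    and G H :: "('a list \<Rightarrow> 'a list) set"
  assumes "subgroup G tree_aut" and "subgroup H tree_aut"
    and "perfect_subgroup tree_aut G" and "perfect_subgroup tree_aut H"
    and "self_similar G" and "self_similar H"
    and "property_H G" and "property_H H"
    and "level_perm ` G = level_perm ` H"
  shows "(\<forall>\<Omega> \<Omega>'. \<Omega> \<subseteq> seqs p \<and> \<Omega> \<noteq> {} \<and> \<Omega>' \<subseteq> seqs p \<and> \<Omega>' \<noteq> {} \<longrightarrow>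
            (\<exists>\<theta>. profinite_isomorphism (Gamma_group p G \<Omega>) (Gamma_group p H \<Omega>') \<theta>)) \<and>
         (\<forall>\<Omega> \<Omega>'. \<Omega> \<subseteq> seqs p \<and> \<Omega> \<noteq> {} \<and> \<Omega>' \<subseteq> seqs p \<and> \<Omega>' \<noteq> {} \<and>
            subgroup G (tree_aut\<lparr>carrier := H\<rparr>) \<and> \<Omega> \<subseteq> \<Omega>' \<longrightarrow>
            subgroup (carrier (Gamma_group p G \<Omega>)) (Gamma_group p H \<Omega>') \<and>
            profinite_isomorphism (Gamma_group p G \<Omega>) (Gamma_group p H \<Omega>')
              (profinite_map (Gamma_group p G \<Omega>) (Gamma_group p H \<Omega>') (\<lambda>x. x)))"
proof -
  have G: "perfect_self_similar G" and H: "perfect_self_similar H"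
    using assms(1-8) by (simp_all add: perfect_self_similar_def)
  define K where "K = generate tree_aut (G \<union> H)"
  have K: "perfect_self_similar K" and perms: "level_perm ` K = level_perm ` G"
    unfolding K_def by (rule perfect_self_similar_join[OF G H assms(9)])+
  have incl: "G \<subseteq> K" "H \<subseteq> K" by (auto simp: K_def intro: generate.incl)
  have "\<exists>\<theta>. profinite_isomorphism (Gamma_group p G \<Omega>) (Gamma_group p H \<Omega>') \<theta>"
    if \<Omega>: "\<Omega> \<subseteq> seqs p" "\<Omega> \<noteq> {}" and \<Omega>': "\<Omega>' \<subseteq> seqs p" "\<Omega>' \<noteq> {}" for \<Omega> \<Omega>'
  proof -
    let ?\<Delta> = "Gamma_group p K (\<Omega> \<union> \<Omega>')"
    have \<Omega>\<Omega>': "\<Omega> \<union> \<Omega>' \<subseteq> seqs p" using \<Omega>(1) \<Omega>'(1) by blast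
    have "\<exists>\<theta>. profinite_isomorphism (Gamma_group p G \<Omega>) ?\<Delta> \<theta>"
      using Gamma_inclusion_profinite_isomorphism[OF G K perms[symmetric] incl(1) \<Omega> \<Omega>\<Omega>'] by blast
    moreover have "\<exists>\<theta>. profinite_isomorphism (Gamma_group p H \<Omega>') ?\<Delta> \<theta>"
      using Gamma_inclusion_profinite_isomorphism[OF H K _ incl(2) \<Omega>' \<Omega>\<Omega>'] perms assms(9) by auto
    moreover have "group (Gamma_group p H \<Omega>')" by (simp add: Gamma_group_def)
    ultimately show ?thesis
      using group.profinite_isomorphism_inverse profinite_isomorphism_compose by metis
  qed
  moreover have "subgroup (carrier (Gamma_group p G \<Omega>)) (Gamma_group p H \<Omega>') \<and>
            profinite_isomorphism (Gamma_group p G \<Omega>) (Gamma_group p H \<Omega>')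
              (profinite_map (Gamma_group p G \<Omega>) (Gamma_group p H \<Omega>') (\<lambda>x. x))"
    if "\<Omega> \<subseteq> seqs p" "\<Omega> \<noteq> {}" "\<Omega>' \<subseteq> seqs p" "subgroup G (tree_aut\<lparr>carrier := H\<rparr>)" "\<Omega> \<subseteq> \<Omega>'" for \<Omega> \<Omega>'
  proof -
    have "G \<subseteq> H" using subgroup.subset[OF that(4)] by simp
    then show ?thesis
      using Gamma_inclusion_profinite_isomorphism[OF G H assms(9) _ that(1-3,5)] by blast
  qed
  ultimately show ?thesis by blast
qed

end
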